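(* Let $K$ and $M$ be integers with $1\le M\le K-1$. For the PIR-CSI--I setting with $K$ messages and side information support size $M$, the capacity and the scalar-linear capacity are both equal to $\left\lceil \frac{K}{M+1}\right\rceil^{-1}$.
   Context: Setup. Let $\mathcal{K}=\{1,\dots,K\}$, let $q$ be a prime power, $l\ge 1$ an integer, $\mathbb{F}_q^{\times}=\mathbb{F}_q\setminus\{0\}$ and $L=l\log_2 q$. Let $\mathcal{S}$ be the set of all $M$-subsets of $\mathcal{K}$ and $\mathcal{C}$ the set of all length-$M$ sequences over $\mathbb{F}_q^{\times}$. Boldface denotes random variables, regular letters their realizations; entropies are Shannon entropies in bits. A server stores messages $\mathbf{X}_1,\dots,\mathbf{X}_K$, i.i.d. uniform on $\mathbb{F}_{q^l}$ (so $H(\mathbf{X}_i)=L$); write $\mathbf{X}_{\mathcal{K}}=\{\mathbf{X}_1,\dots,\mathbf{X}_K\}$. A user wants $X_W$ ($W\in\mathcal{K}$ is the demand index) and knows the coded side information $Y^{[S,C]}=\sum_{i\in S}c_iX_i$, where $S=\{i_1,\dots,i_M\}\in\mathcal{S}$ (the support index set) and $C=(c_{i_1},\dots,c_{i_M})\in\mathcal{C}$. $\mathbf{S}$ is uniform on $\mathcal{S}$, $\mathbf{C}$ is uniform on $\mathcal{C}$ and independent of $(\mathbf{W},\mathbf{S})$, and the messages are independent of $(\mathbf{W},\mathbf{S},\mathbf{C})$. Model I: given $\mathbf{S}=S$, $\mathbf{W}$ is uniform on $\mathcal{K}\setminus S$ (so the indicator $\mathds{1}_{\{\mathbf{W}\in\mathbf{S}\}}$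 equals $0$). Protocol. The user sends a query $\mathbf{Q}=\mathbf{Q}^{[\mathbf{W},\mathbf{S},\mathbf{C}]}$, a possibly stochastic function of $(\mathbf{W},\mathbf{S},\mathbf{C})$ only (any extra randomness is independent of the messages). The server replies with an answer $\mathbf{A}=\mathbf{A}^{[\mathbf{W},\mathbf{S},\mathbf{C}]}$, a deterministic function of $\mathbf{Q}$, the indicator $\mathds{1}_{\{\mathbf{W}\in\mathbf{S}\}}$ and $\mathbf{X}_{\mathcal{K}}$. Recoverability: $H(\mathbf{X}_{\mathbf{W}}\mid \mathbf{A},\mathbf{Q},\mathds{1}_{\{\mathbf{W}\in\mathbf{S}\}},\mathbf{Y}^{[\mathbf{S},\mathbf{C}]},\mathbf{W},\mathbf{S},\mathbf{C})=0$. $W$-privacy: $I(\mathbf{W};\mathbf{Q}\mid \mathds{1}_{\{\mathbf{W}\in\mathbf{S}\}})=0$. A PIR-CSI--I protocol is a protocol under Model I satisfying recoverability and $W$-privacy. Its rate is $L/H(\mathbf{A}\mid \mathds{1}_{\{\mathbf{W}\in\mathbf{S}\}}=0)$. It is scalar-linear if the answer consists only of linear combinations of $X_1,\dots,X_K$ with coefficients in $\mathbb{F}_q$ (the coefficients being determined by the query). The capacity (resp. scalar-linear capacity) of the setting is the supremum of the rates over all (resp. all scalar-linear) PIR-CSI--I protocols and over all prime powers $q$ and all $l\ge1$. *)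

theory Defs
  imports
    "HOL-Probability.Probability"
    "HOL-Algebra.Subrings"
    "HOL-Number_Theory.Prime_Powers"
    "HOL-Library.Monad_Syntax"
begin

section \<open>Entropies of discrete random variables, in bits\<close>

text \<open>
  The entropies of \<^theory>\<open>HOL-Probability.Information\<close> are taken with respect to
  \<^term>\<open>count_space (X ` space N)\<close>, which has to be \<open>\<sigma>\<close>-finite for the Radon-Nikodym derivatives
  in their definitions to be meaningful. A \<^const>\<open>measure_pmf\<close> has the whole type as its space;
  restricting it to its (countable) support makes every such counting space countable.
\<close>

definition pmf_space :: "'a pmf \<Rightarrow> 'a measure" where
  "pmf_space p = restrict_space (measure_pmf p) (set_pmf p)"

lemma space_pmf_space [simp]: "space (pmf_space p) = set_pmf p"
  by (simp add: pmf_space_def space_restrict_space)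

lemma sets_pmf_space [simp]: "sets (pmf_space p) = Pow (set_pmf p)"
  by (auto simp: pmf_space_def sets_restrict_space image_iff)

lemma prob_space_pmf_space: "prob_space (pmf_space p)"
  unfolding pmf_space_def
  by (intro prob_spaceI)
     (simp add: space_restrict_space emeasure_restrict_space measure_pmf.emeasure_eq_1_AE AE_measure_pmf)

lemma information_space_pmf_space: "information_space (pmf_space p) 2"
  by (intro information_space.intro prob_space_pmf_space information_space_axioms.intro) simp

definition cond_entropy_bits :: "'a pmf \<Rightarrow> ('a \<Rightarrow> 'b) \<Rightarrow> ('a \<Rightarrow> 'c) \<Rightarrow> real" where
  "cond_entropy_bits p X Y =
     prob_space.conditional_entropy (pmf_space p) 2
       (count_space (X ` set_pmf p)) (count_space (Y ` set_pmf p)) X Y"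

definition cond_mutual_info_bits ::
    "'a pmf \<Rightarrow> ('a \<Rightarrow> 'b) \<Rightarrow> ('a \<Rightarrow> 'c) \<Rightarrow> ('a \<Rightarrow> 'd) \<Rightarrow> real" where
  "cond_mutual_info_bits p X Y Z =
     prob_space.conditional_mutual_information (pmf_space p) 2
       (count_space (X ` set_pmf p)) (count_space (Y ` set_pmf p)) (count_space (Z ` set_pmf p)) X Y Z"

text \<open>
  A variable with countably many values may have infinite entropy, in which case the real-valued
  library entropy is the integral of a non-integrable function, hence 0. The value \<open>\<infinity>\<close> is
  therefore assigned explicitly.
\<close>

definition entropy_bits :: "'a pmf \<Rightarrow> ('a \<Rightarrow> 'b) \<Rightarrow> ereal" where
  "entropy_bits p X =
     (let V = count_space (X ` set_pmf p) in
      if \<exists>f. information_space.finite_entropy (pmf_space p) 2 V X f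
      then ereal (prob_space.entropy (pmf_space p) 2 V X) else \<infinity>)"


section \<open>Private information retrieval with coded side information, Model I\<close>

text \<open>\<open>F\<close> is the field with \<open>q ^ l\<close> elements and \<open>k\<close> its subfield with \<open>q\<close> elements.\<close>

definition finite_field_ext :: "nat \<Rightarrow> nat \<Rightarrow> 'f ring \<Rightarrow> 'f set \<Rightarrow> bool" where
  "finite_field_ext q l F k \<longleftrightarrow>
     primepow q \<and> l \<ge> 1 \<and> field F \<and> subfield k F \<and> card k = q \<and> card (carrier F) = q ^ l"

definition support_sets :: "nat \<Rightarrow> nat \<Rightarrow> nat set set" where
  "support_sets K M = {S. S \<subseteq> {1..K} \<and> card S = M}"

definition coeff_seqs :: "nat \<Rightarrow> 'f ring \<Rightarrow> 'f set \<Rightarrow> 'f list set" where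
  "coeff_seqs M F k = {C. length C = M \<and> set C \<subseteq> k - {\<zero>\<^bsub>F\<^esub>}}"

definition message_tuples :: "nat \<Rightarrow> 'f ring \<Rightarrow> (nat \<Rightarrow> 'f) set" where
  "message_tuples K F = {1..K} \<rightarrow>\<^sub>E carrier F"

text \<open>The \<open>j\<close>-th coefficient belongs to the \<open>j\<close>-th smallest index of the support.\<close>

definition side_info :: "'f ring \<Rightarrow> nat set \<Rightarrow> 'f list \<Rightarrow> (nat \<Rightarrow> 'f) \<Rightarrow> 'f" where
  "side_info F S C X =
     (\<Oplus>\<^bsub>F\<^esub>j\<in>{..<card S}. C ! j \<otimes>\<^bsub>F\<^esub> X (sorted_list_of_set S ! j))"

record ('f, 'q) outcome =
  Demand :: nat
  Supp :: "nat set"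
  Coeffs :: "'f list"
  Msgs :: "nat \<Rightarrow> 'f"
  Query :: 'q

type_synonym ('f, 'q) query_kernel = "nat \<Rightarrow> nat set \<Rightarrow> 'f list \<Rightarrow> 'q pmf"

type_synonym ('f, 'q, 'a) answer_map = "'q \<Rightarrow> bool \<Rightarrow> (nat \<Rightarrow> 'f) \<Rightarrow> 'a"

definition model_I ::
    "nat \<Rightarrow> nat \<Rightarrow> 'f ring \<Rightarrow> 'f set \<Rightarrow> ('f, 'q) query_kernel \<Rightarrow> ('f, 'q) outcome pmf" where
  "model_I K M F k query = do {
     S \<leftarrow> pmf_of_set (support_sets K M);
     W \<leftarrow> pmf_of_set ({1..K} - S);
     C \<leftarrow> pmf_of_set (coeff_seqs M F k);
     X \<leftarrow> pmf_of_set (message_tuples K F);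
     Q \<leftarrow> query W S C;
     return_pmf \<lparr>Demand = W, Supp = S, Coeffs = C, Msgs = X, Query = Q\<rparr>
   }"

definition demand_in_supp :: "('f, 'q) outcome \<Rightarrow> bool" where
  "demand_in_supp \<omega> \<longleftrightarrow> Demand \<omega> \<in> Supp \<omega>"

definition Answer :: "('f, 'q, 'a) answer_map \<Rightarrow> ('f, 'q) outcome \<Rightarrow> 'a" where
  "Answer answer \<omega> = answer (Query \<omega>) (demand_in_supp \<omega>) (Msgs \<omega>)"

definition recoverable ::
    "'f ring \<Rightarrow> ('f, 'q) outcome pmf \<Rightarrow> ('f, 'q, 'a) answer_map \<Rightarrow> bool" where
  "recoverable F p answer \<longleftrightarrow>
     cond_entropy_bits p (\<lambda>\<omega>. Msgs \<omega> (Demand \<omega>))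
       (\<lambda>\<omega>. (Answer answer \<omega>, Query \<omega>, demand_in_supp \<omega>,
             side_info F (Supp \<omega>) (Coeffs \<omega>) (Msgs \<omega>), Demand \<omega>, Supp \<omega>, Coeffs \<omega>)) = 0"

definition W_private :: "('f, 'q) outcome pmf \<Rightarrow> bool" where
  "W_private p \<longleftrightarrow> cond_mutual_info_bits p Demand Query demand_in_supp = 0"

definition pir_csi_I ::
    "nat \<Rightarrow> nat \<Rightarrow> 'f ring \<Rightarrow> 'f set \<Rightarrow> ('f, 'q) query_kernel \<Rightarrow> ('f, 'q, 'a) answer_map \<Rightarrow> bool" where
  "pir_csi_I K M F k query answer \<longleftrightarrow>
     recoverable F (model_I K M F k query) answer \<and> W_private (model_I K M F k query)"

definition scalar_linear ::
    "nat \<Rightarrow> 'f ring \<Rightarrow> 'f set \<Rightarrow> ('f, 'q, 'f list) answer_map \<Rightarrow> bool" where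
  "scalar_linear K F k answer \<longleftrightarrow>
     (\<exists>coeffs :: 'q \<Rightarrow> (nat \<Rightarrow> 'f) list.
        (\<forall>Q. \<forall>a\<in>set (coeffs Q). \<forall>i\<in>{1..K}. a i \<in> k) \<and>
        (\<forall>Q b. \<forall>X\<in>message_tuples K F.
           answer Q b X = map (\<lambda>a. \<Oplus>\<^bsub>F\<^esub>i\<in>{1..K}. a i \<otimes>\<^bsub>F\<^esub> X i) (coeffs Q)))"

definition rate ::
    "nat \<Rightarrow> nat \<Rightarrow> nat \<Rightarrow> nat \<Rightarrow> 'f ring \<Rightarrow> 'f set \<Rightarrow> ('f, 'q) query_kernel \<Rightarrow> ('f, 'q, 'a) answer_map \<Rightarrow> ereal" where
  "rate K M q l F k query answer =
     ereal (real l * log 2 (real q)) /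
     entropy_bits (cond_pmf (model_I K M F k query) {\<omega>. \<not> demand_in_supp \<omega>}) (Answer answer)"

text \<open>
  A query has countably many values, and so has the answer, being a function of the query, the
  indicator and the finitely many message tuples. Up to renaming of symbols, queries are therefore
  natural numbers, answers are lists of natural numbers, and the finite fields have natural numbers
  as elements; for scalar-linear protocols an answer is then a list of field elements.
\<close>

definition capacity :: "nat \<Rightarrow> nat \<Rightarrow> ereal" where
  "capacity K M =
     Sup {rate K M q l F k query answer | q l (F :: nat ring) k
            (query :: (nat, nat) query_kernel) (answer :: (nat, nat, nat list) answer_map).
          finite_field_ext q l F k \<and> pir_csi_I K M F k query answer}"

definition scalar_linear_capacity :: "nat \<Rightarrow> nat \<Rightarrow> ereal" where
  "scalar_linear_capacity K M =
     Sup {rate K M q l F k query answer | q l (F :: nat ring) k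
            (query :: (nat, nat) query_kernel) (answer :: (nat, nat, nat list) answer_map).
          finite_field_ext q l F k \<and> pir_csi_I K M F k query answer \<and> scalar_linear K F k answer}"

end

theory Submission
  imports Defs
begin

text \<open>
  Converse: by privacy every query that occurs is compatible with every demand \<open>i\<close>, so, given the
  answer to that query, \<open>X i\<close> is a function of \<open>M\<close> other messages. Choosing such \<open>i\<close> greedily shows
  that \<open>n = \<lceil>K / (M + 1)\<rceil>\<close> of the messages are determined by the answer and the remaining ones. Hence
  given the query each answer has at most \<open>(q ^ l) ^ (K - n)\<close> preimages among the message tuples, no
  answer has probability above \<open>(q ^ l) ^ (- n)\<close>, and the answer has entropy at least \<open>n L\<close>.

  Achievability: it suffices to use \<open>q = 2\<close>, \<open>l = 1\<close>, where all coefficients are 1. Cover the positions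
  \<open>{..<K}\<close> by \<open>n\<close> blocks of size \<open>M + 1\<close>, pick a uniform position \<open>w\<close> and a uniform ordering of
  the messages subject to the demand being at \<open>w\<close> and the support filling the rest of the block of \<open>w\<close>.
  Unconditionally, the ordering is uniform and independent of \<open>w\<close>, so that the demand is uniform given
  the ordering, which is the query. The answer consists of the \<open>n\<close> block sums.
\<close>

section \<open>Entropies of discrete variables\<close>

lemma integral_pmf_space: "(\<integral>\<omega>. g \<omega> \<partial>pmf_space p) = measure_pmf.expectation p (g :: _ \<Rightarrow> real)"
  unfolding pmf_space_def
  by (subst integral_restrict_space)
     (auto intro!: integral_cong_AE simp: AE_measure_pmf_iff)

text \<open>\<open>A\<close> may exceed the range of \<open>X\<close>: for a pair of variables the
  counting space lives on the product of the two ranges, which can be larger than the range of the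
  pair.\<close>

lemma distributed_pmf_space:
  assumes "countable A" "X ` set_pmf p \<subseteq> A"
  shows "distributed (pmf_space p) (count_space A) X (\<lambda>x. ennreal (pmf (map_pmf X p) x))"
  unfolding distributed_def
proof (intro conjI)
  show X: "X \<in> pmf_space p \<rightarrow>\<^sub>M count_space A"
    using assms by (auto simp: measurable_def)
  show "distr (pmf_space p) (count_space A) X = density (count_space A) (\<lambda>x. ennreal (pmf (map_pmf X p) x))"
  proof (rule measure_eqI_countable[where A = A])
    fix a assume a: "a \<in> A"
    have "emeasure (distr (pmf_space p) (count_space A) X) {a} = emeasure (pmf_space p) (X -` {a} \<inter> set_pmf p)"
      using X a by (subst emeasure_distr) auto
    also have "\<dots> = emeasure (measure_pmf p) (X -` {a} \<inter> set_pmf p)"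
      unfolding pmf_space_def by (subst emeasure_restrict_space) auto
    also have "\<dots> = emeasure (measure_pmf p) (X -` {a})"
      by (simp add: emeasure_Int_set_pmf)
    also have "\<dots> = ennreal (pmf (map_pmf X p) a)"
      by (simp add: pmf_map measure_pmf.emeasure_eq_measure)
    also have "\<dots> = emeasure (density (count_space A) (\<lambda>x. ennreal (pmf (map_pmf X p) x))) {a}"
      using a by (subst emeasure_density)
        (auto simp: nn_integral_count_space_indicator[symmetric]
          nn_integral_indicator_singleton emeasure_count_space_finite)
    finally show "emeasure (distr (pmf_space p) (count_space A) X) {a} = \<dots>" .
  qed (use assms in auto)
qed auto

lemma expectation_distributed_pmf_space:
  fixes g :: "_ \<Rightarrow> real"
  assumes "countable A" "X ` set_pmf p \<subseteq> A"
  shows "(\<integral>x. pmf (map_pmf X p) x * g x \<partial>count_space A) = measure_pmf.expectation p (\<lambda>\<omega>. g (X \<omega>))"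
  using distributed_integral[OF distributed_pmf_space[OF assms], of g] by (simp add: integral_pmf_space)

lemma pair_measure_countable_image:
  "count_space (X ` set_pmf p) \<Otimes>\<^sub>M count_space (Y ` set_pmf p) = count_space (X ` set_pmf p \<times> Y ` set_pmf p)"
  by (intro pair_measure_countable) auto

lemma mutual_information_pmf_space:
  assumes A: "countable A" "X ` set_pmf p \<subseteq> A" and B: "countable B" "Y ` set_pmf p \<subseteq> B"
  shows "prob_space.mutual_information (pmf_space p) 2 (count_space A) (count_space B) X Y =
    measure_pmf.expectation p (\<lambda>\<omega>. log 2
      (pmf (map_pmf (\<lambda>\<omega>. (X \<omega>, Y \<omega>)) p) (X \<omega>, Y \<omega>) /
       (pmf (map_pmf X p) (X \<omega>) * pmf (map_pmf Y p) (Y \<omega>))))"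
proof -
  interpret information_space "pmf_space p" 2 by (rule information_space_pmf_space)
  have AB: "countable (A \<times> B)" "(\<lambda>\<omega>. (X \<omega>, Y \<omega>)) ` set_pmf p \<subseteq> A \<times> B"
    using A B by auto
  note P = pair_measure_countable[OF A(1) B(1)]
  show ?thesis
    by (subst mutual_information_distr[OF sigma_finite_measure_count_space_countable[OF A(1)]
          sigma_finite_measure_count_space_countable[OF B(1)]
          distributed_pmf_space[OF A] _ distributed_pmf_space[OF B] _
          distributed_pmf_space[OF AB, folded P]])
       (simp_all add: P expectation_distributed_pmf_space[OF AB])
qed

lemma cond_entropy_bits_expectation:
  "cond_entropy_bits p X Y = - measure_pmf.expectation p (\<lambda>\<omega>. log 2
      (pmf (map_pmf (\<lambda>\<omega>. (X \<omega>, Y \<omega>)) p) (X \<omega>, Y \<omega>) / pmf (map_pmf Y p) (Y \<omega>)))"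
proof -
  interpret information_space "pmf_space p" 2 by (rule information_space_pmf_space)
  define A B where "A = X ` set_pmf p" and "B = Y ` set_pmf p"
  have A: "countable A" "X ` set_pmf p \<subseteq> A" and B: "countable B" "Y ` set_pmf p \<subseteq> B"
    by (auto simp: A_def B_def)
  then have AB: "countable (A \<times> B)" "(\<lambda>\<omega>. (X \<omega>, Y \<omega>)) ` set_pmf p \<subseteq> A \<times> B"
    by auto
  note P = pair_measure_countable[OF A(1) B(1)]
  show ?thesis unfolding cond_entropy_bits_def A_def[symmetric] B_def[symmetric]
    by (subst conditional_entropy_generic_eq[OF sigma_finite_measure_count_space_countable[OF A(1)]
          sigma_finite_measure_count_space_countable[OF B(1)]
          distributed_pmf_space[OF B] _
          distributed_pmf_space[OF AB, folded P]])
       (simp_all add: P case_prod_beta' expectation_distributed_pmf_space[OF AB])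
qed

section \<open>Gibbs' inequality and its equality case\<close>

text \<open>The weight \<open>pmf J z\<close> cancels the denominator, so what remains is the mass
  that \<open>r\<close> puts on the support of \<open>J\<close>. Points outside that support
  contribute nothing, because division by zero gives zero.\<close>

lemma integral_pmf_ratio:
  fixes J r :: "'a pmf"
  shows "integrable (measure_pmf J) (\<lambda>z. pmf r z / pmf J z)"
    and "measure_pmf.expectation J (\<lambda>z. pmf r z / pmf J z) = measure_pmf.prob r (set_pmf J)"
proof -
  have "(\<integral>\<^sup>+z. ennreal (pmf r z / pmf J z) \<partial>measure_pmf J)
      = (\<integral>\<^sup>+z. ennreal (pmf J z) * ennreal (pmf r z / pmf J z) \<partial>count_space UNIV)"
    by (rule nn_integral_measure_pmf)
  also have "\<dots> = (\<integral>\<^sup>+z. ennreal (pmf r z) * indicator (set_pmf J) z \<partial>count_space UNIV)"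
    by (intro nn_integral_cong)
       (auto simp: ennreal_mult[symmetric] indicator_def set_pmf_iff)
  also have "\<dots> = (\<integral>\<^sup>+z. indicator (set_pmf J) z \<partial>measure_pmf r)"
    by (rule nn_integral_measure_pmf[symmetric])
  also have "\<dots> = ennreal (measure_pmf.prob r (set_pmf J))"
    by (simp add: measure_pmf.emeasure_eq_measure)
  finally have *: "(\<integral>\<^sup>+z. ennreal (pmf r z / pmf J z) \<partial>measure_pmf J) = ennreal (measure_pmf.prob r (set_pmf J))" .
  show "integrable (measure_pmf J) (\<lambda>z. pmf r z / pmf J z)"
    by (rule integrableI_nonneg) (auto simp: *)
  show "measure_pmf.expectation J (\<lambda>z. pmf r z / pmf J z) = measure_pmf.prob r (set_pmf J)"
    by (subst integral_eq_nn_integral) (auto simp: *)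
qed

text \<open>With \<open>t = pmf J z / pmf r z\<close> in \<open>(0, c]\<close>, the positive part of
  \<open>ln t\<close> is bounded by \<open>c\<close> and the negative part by \<open>1 / t\<close>,
  which is integrable by \<open>integral_pmf_ratio\<close>. Integrability matters because a
  non-integrable function has integral 0, which would make a vanishing information
  meaningless.\<close>

lemma integrable_ln_pmf_ratio:
  fixes J r :: "'a pmf"
  assumes c: "\<And>z. pmf J z \<le> c * pmf r z"
  shows "integrable (measure_pmf J) (\<lambda>z. ln (pmf J z / pmf r z))"
proof (rule Bochner_Integration.integrable_bound)
  show "integrable (measure_pmf J) (\<lambda>z. c + pmf r z / pmf J z)"
    by (intro Bochner_Integration.integrable_add integral_pmf_ratio) simp
  show "AE z in measure_pmf J. norm (ln (pmf J z / pmf r z)) \<le> norm (c + pmf r z / pmf J z)"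
  proof (rule AE_pmfI)
    fix z assume "z \<in> set_pmf J"
    then have J: "pmf J z > 0" by (simp add: pmf_positive)
    with c[of z] have "c * pmf r z > 0" by linarith
    then have r: "pmf r z > 0" "c > 0"
      by (auto simp: zero_less_mult_iff dest: leD)
    define t where "t = pmf J z / pmf r z"
    have t: "t > 0" "t \<le> c" and t': "pmf r z / pmf J z = 1 / t"
      using J r c[of z] by (auto simp: t_def field_simps)
    have "ln t \<le> t - 1" "ln (1 / t) \<le> 1 / t - 1"
      using t by (auto intro!: ln_le_minus_one)
    then have "\<bar>ln t\<bar> \<le> c + 1 / t"
      using t by (auto simp: ln_div abs_if intro: order_trans[of _ t] add_increasing2)
    then show "norm (ln (pmf J z / pmf r z)) \<le> norm (c + pmf r z / pmf J z)"
      unfolding t' unfolding t_def[symmetric] using t r by simp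
  qed
qed simp

text \<open>With \<open>u = pmf r z / pmf J z\<close>, the function \<open>g = u - 1 - ln u\<close>
  is nonnegative, while its mean under \<open>J\<close> is the \<open>r\<close>-mass of the support
  of \<open>J\<close> minus 1, hence at most 0. So \<open>g\<close> vanishes almost surely, which
  forces \<open>u = 1\<close>, and \<open>r\<close> has no mass outside the support of
  \<open>J\<close>.\<close>

lemma pmf_eq_of_expectation_ln_ratio_0:
  fixes J r :: "'a pmf"
  assumes c: "\<And>z. pmf J z \<le> c * pmf r z"
    and 0: "measure_pmf.expectation J (\<lambda>z. ln (pmf J z / pmf r z)) = 0"
  shows "J = r"
proof -
  define g where "g z = ln (pmf J z / pmf r z) - 1 + pmf r z / pmf J z" for z
  have pos: "pmf J z > 0 \<and> pmf r z > 0" if "z \<in> set_pmf J" for z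
    using that c[of z] pmf_nonneg[of r z] pmf_positive[OF that]
    by (cases "pmf r z = 0") auto
  have ln: "ln (pmf J z / pmf r z) = - ln (pmf r z / pmf J z)" if "z \<in> set_pmf J" for z
    using pos[OF that] by (simp add: ln_div)
  have nn: "g z \<ge> 0" if "z \<in> set_pmf J" for z
    unfolding g_def ln[OF that] using pos[OF that] ln_le_minus_one[of "pmf r z / pmf J z"] by simp
  have int: "integrable (measure_pmf J) g"
    unfolding g_def by (intro Bochner_Integration.integrable_add Bochner_Integration.integrable_diff
        integral_pmf_ratio integrable_ln_pmf_ratio[OF c]) simp
  have E: "measure_pmf.expectation J g = measure_pmf.prob r (set_pmf J) - 1"
    unfolding g_def using integrable_ln_pmf_ratio[OF c] integral_pmf_ratio[of J r]
    by (simp add: 0)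
  have "measure_pmf.expectation J g \<ge> 0"
    by (rule integral_nonneg_AE) (auto intro!: AE_pmfI nn)
  then have r1: "measure_pmf.prob r (set_pmf J) = 1" and E0: "measure_pmf.expectation J g = 0"
    using E measure_pmf.prob_le_1[of r "set_pmf J"] by linarith+
  have "AE z in measure_pmf J. g z = 0"
    using integral_nonneg_eq_0_iff_AE[OF int] E0 nn by (auto simp: AE_measure_pmf_iff)
  then have eq: "pmf J z = pmf r z" if "z \<in> set_pmf J" for z
    using that ln_eq_minus_one[of "pmf r z / pmf J z"] pos[OF that] ln[OF that]
    by (auto simp: AE_measure_pmf_iff g_def)
  have sub: "set_pmf r \<subseteq> set_pmf J"
    using r1 by (auto simp: measure_pmf.prob_eq_1 AE_measure_pmf_iff)
  show ?thesis
  proof (rule pmf_eqI)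
    fix z show "pmf J z = pmf r z"
      using eq[of z] sub by (cases "z \<in> set_pmf J") (auto simp: set_pmf_iff)
  qed
qed

section \<open>Vanishing information as independence, vanishing conditional entropy as
  determination\<close>

lemma pmf_map_pair_le:
  "pmf (map_pmf (\<lambda>\<omega>. (X \<omega>, Y \<omega>)) p) (x, y) \<le> pmf (map_pmf Y p) y"
  by (auto simp: pmf_map intro!: measure_pmf.finite_measure_mono)

text \<open>Mutual information is the divergence of the joint law \<open>J\<close> from the product
  \<open>r\<close> of its marginals, so the equality case of Gibbs' inequality applies. Finiteness
  of the range of \<open>X\<close> supplies the domination of \<open>J\<close> by a multiple of
  \<open>r\<close>.\<close>

lemma mutual_information_pmf_space_eq_0_iff:
  assumes A: "countable A" "X ` set_pmf p \<subseteq> A" and B: "countable B" "Y ` set_pmf p \<subseteq> B"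
    and fin: "finite (X ` set_pmf p)"
  shows "prob_space.mutual_information (pmf_space p) 2 (count_space A) (count_space B) X Y = 0 \<longleftrightarrow>
    map_pmf (\<lambda>\<omega>. (X \<omega>, Y \<omega>)) p = pair_pmf (map_pmf X p) (map_pmf Y p)"
proof -
  define J where "J = map_pmf (\<lambda>\<omega>. (X \<omega>, Y \<omega>)) p"
  define r where "r = pair_pmf (map_pmf X p) (map_pmf Y p)"
  \<comment> \<open>Since \<open>pmf J (x, y)\<close> is at most the mass of \<open>y\<close>, any
    constant above all \<open>1 / pmf (map_pmf X p) x\<close> dominates; the finite sum is
    one.\<close>
  define c where "c = (\<Sum>x\<in>X ` set_pmf p. 1 / pmf (map_pmf X p) x)"
  have MI: "prob_space.mutual_information (pmf_space p) 2 (count_space A) (count_space B) X Y =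
      measure_pmf.expectation J (\<lambda>z. ln (pmf J z / pmf r z)) / ln 2"
    unfolding mutual_information_pmf_space[OF A B]
    by (simp add: J_def r_def log_def pmf_pair)
  have c: "pmf J z \<le> c * pmf r z" for z
  proof (cases z)
    case (Pair x y)
    have J: "pmf J z \<le> pmf (map_pmf Y p) y"
      unfolding J_def Pair by (rule pmf_map_pair_le)
    show ?thesis
    proof (cases "z \<in> set_pmf J")
      case False
      then show ?thesis
        by (auto simp: set_pmf_iff c_def intro!: mult_nonneg_nonneg sum_nonneg)
    next
      case True
      then have x: "x \<in> X ` set_pmf p" by (auto simp: J_def Pair)
      then have px: "pmf (map_pmf X p) x > 0" by (intro pmf_positive) simp
      have "1 / pmf (map_pmf X p) x \<le> c"
        unfolding c_def using fin x by (intro member_le_sum) auto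
      then have "1 \<le> c * pmf (map_pmf X p) x" using px by (simp add: field_simps)
      from mult_right_mono[OF this, of "pmf (map_pmf Y p) y"] J show ?thesis
        by (simp add: r_def Pair pmf_pair mult.assoc)
    qed
  qed
  show ?thesis
  proof
    assume "map_pmf (\<lambda>\<omega>. (X \<omega>, Y \<omega>)) p = pair_pmf (map_pmf X p) (map_pmf Y p)"
    then have "J = r" by (simp add: J_def r_def)
    have "measure_pmf.expectation r (\<lambda>z. ln (pmf r z / pmf r z)) = measure_pmf.expectation r (\<lambda>z. 0)"
      by (intro integral_cong_AE AE_pmfI) (auto simp: set_pmf_iff)
    with \<open>J = r\<close>
    show "prob_space.mutual_information (pmf_space p) 2 (count_space A) (count_space B) X Y = 0"
      unfolding MI by simp
  qed (use pmf_eq_of_expectation_ln_ratio_0[OF c] in \<open>auto simp: MI J_def r_def\<close>)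
qed

text \<open>Conditional mutual information is I(X; (Y, Z)) - I(X; Z). For constant \<open>Z\<close>
  the second term is 0, and appending the constant to \<open>Y\<close> is injective, so the first
  one vanishes exactly when \<open>X\<close> and \<open>Y\<close> are independent.\<close>

lemma cond_mutual_info_bits_eq_0_iff:
  fixes X :: "'a \<Rightarrow> 'b" and Y :: "'a \<Rightarrow> 'c"
  assumes fin: "finite (X ` set_pmf p)" and Z: "\<And>\<omega>. \<omega> \<in> set_pmf p \<Longrightarrow> Z \<omega> = c"
  shows "cond_mutual_info_bits p X Y Z = 0 \<longleftrightarrow>
    map_pmf (\<lambda>\<omega>. (X \<omega>, Y \<omega>)) p = pair_pmf (map_pmf X p) (map_pmf Y p)"
proof -
  interpret prob_space "pmf_space p" by (rule prob_space_pmf_space)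
  have YZ: "map_pmf (\<lambda>\<omega>. (Y \<omega>, Z \<omega>)) p = map_pmf (\<lambda>y. (y, c)) (map_pmf Y p)"
    unfolding map_pmf_comp by (rule map_pmf_cong) (auto simp: Z)
  have XYZ: "map_pmf (\<lambda>\<omega>. (X \<omega>, (Y \<omega>, Z \<omega>))) p
      = map_pmf (\<lambda>(x, y). (x, (y, c))) (map_pmf (\<lambda>\<omega>. (X \<omega>, Y \<omega>)) p)"
    unfolding map_pmf_comp by (rule map_pmf_cong) (auto simp: Z)
  have Zc: "map_pmf Z p = return_pmf c"
    using map_pmf_cong[of p p Z "\<lambda>_. c"] by (simp add: map_pmf_const Z)
  have XZ: "map_pmf (\<lambda>\<omega>. (X \<omega>, Z \<omega>)) p = pair_pmf (map_pmf X p) (map_pmf Z p)"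
    unfolding Zc pair_return_pmf2 map_pmf_comp by (rule map_pmf_cong) (auto simp: Z)
  have 0: "mutual_information 2 (count_space (X ` set_pmf p)) (count_space (Z ` set_pmf p)) X Z = 0"
    by (subst mutual_information_pmf_space_eq_0_iff) (auto simp: fin XZ)
  have inj: "inj (\<lambda>(x :: 'b, y :: 'c). (x, (y, c)))" by (auto simp: inj_def)
  have pair: "pair_pmf (map_pmf X p) (map_pmf (\<lambda>\<omega>. (Y \<omega>, Z \<omega>)) p)
      = map_pmf (\<lambda>(x, y). (x, (y, c))) (pair_pmf (map_pmf X p) (map_pmf Y p))"
    unfolding YZ using map_pair[of id "\<lambda>y. (y, c)" "map_pmf X p" "map_pmf Y p"]
    by (simp add: map_prod_def case_prod_beta')
  have "mutual_information 2 (count_space (X ` set_pmf p))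
      (count_space (Y ` set_pmf p) \<Otimes>\<^sub>M count_space (Z ` set_pmf p)) X (\<lambda>\<omega>. (Y \<omega>, Z \<omega>)) = 0 \<longleftrightarrow>
    map_pmf (\<lambda>\<omega>. (X \<omega>, Y \<omega>)) p = pair_pmf (map_pmf X p) (map_pmf Y p)"
    unfolding pair_measure_countable_image
    by (subst mutual_information_pmf_space_eq_0_iff)
       (auto simp: fin pair XYZ dest: injD[OF pmf.inj_map[OF inj]])
  then show ?thesis
    unfolding cond_mutual_info_bits_def conditional_mutual_information_def 0 by simp
qed

text \<open>Conditional entropy is the mean of \<open>- ln (h z) / ln 2\<close> with
  \<open>h\<close> the conditional probability of \<open>X\<close> given \<open>Y\<close>. The
  integrand is nonnegative, so a zero mean forces \<open>h = 1\<close> on the support, provided it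
  is integrable.\<close>

lemma cond_entropy_bits_eq_0_iff:
  assumes fin: "finite (X ` set_pmf p)"
  shows "cond_entropy_bits p X Y = 0 \<longleftrightarrow>
    (\<forall>\<omega>\<in>set_pmf p. \<forall>\<omega>'\<in>set_pmf p. Y \<omega> = Y \<omega>' \<longrightarrow> X \<omega> = X \<omega>')"
proof -
  define J where "J = map_pmf (\<lambda>\<omega>. (X \<omega>, Y \<omega>)) p"
  define A where "A = X ` set_pmf p"
  \<comment> \<open>A reference law that serves only for integrability:
    \<open>pmf J z / pmf r z\<close> equals \<open>N * h z\<close> on the support of
    \<open>J\<close>, and \<open>J\<close> is dominated by \<open>N\<close> times
    \<open>r\<close>.\<close>
  define r where "r = pair_pmf (pmf_of_set A) (map_pmf Y p)"
  define N where "N = real (card A)"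
  define h where "h z = pmf J z / pmf (map_pmf Y p) (snd z)" for z
  have A: "finite A" "A \<noteq> {}" using fin by (auto simp: A_def set_pmf_not_empty)
  then have N: "N > 0" by (auto simp: N_def card_gt_0_iff)
  have pr: "pmf r (x, y) = pmf (map_pmf Y p) y / N" if "x \<in> A" for x y
    using A that by (simp add: r_def pmf_pair N_def)
  have setJ: "fst z \<in> A \<and> pmf (map_pmf Y p) (snd z) > 0 \<and> pmf J z > 0" if "z \<in> set_pmf J" for z
    using that by (auto simp: J_def A_def intro!: pmf_positive)
  have h: "0 < h z" "h z \<le> 1" if "z \<in> set_pmf J" for z
    using setJ[OF that] pmf_map_pair_le[of X Y p "fst z" "snd z"]
    by (auto simp: h_def J_def)
  have c: "pmf J z \<le> N * pmf r z" for z
  proof (cases "z \<in> set_pmf J")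
    case True
    then show ?thesis
      using setJ[OF True] pr[of "fst z" "snd z"] N pmf_map_pair_le[of X Y p "fst z" "snd z"]
      by (auto simp: J_def)
  next
    case False
    then show ?thesis using N by (auto simp: set_pmf_iff)
  qed
  have ln: "ln (h z) = ln (pmf J z / pmf r z) - ln N" if "z \<in> set_pmf J" for z
    using setJ[OF that] pr[of "fst z" "snd z"] N by (simp add: h_def ln_div ln_mult)
  have int: "integrable (measure_pmf J) (\<lambda>z. - ln (h z))"
  proof (subst integrable_cong_AE)
    show "AE z in measure_pmf J. - ln (h z) = ln N - ln (pmf J z / pmf r z)"
      by (rule AE_pmfI) (simp add: ln)
    show "integrable (measure_pmf J) (\<lambda>z. ln N - ln (pmf J z / pmf r z))"
      by (intro Bochner_Integration.integrable_diff integrable_ln_pmf_ratio[OF c]) simp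
  qed auto
  have "cond_entropy_bits p X Y = measure_pmf.expectation J (\<lambda>z. - ln (h z)) / ln 2"
    unfolding cond_entropy_bits_expectation by (simp add: J_def h_def log_def)
  then have "cond_entropy_bits p X Y = 0 \<longleftrightarrow> measure_pmf.expectation J (\<lambda>z. - ln (h z)) = 0"
    by simp
  also have "\<dots> \<longleftrightarrow> (\<forall>z\<in>set_pmf J. - ln (h z) = 0)"
    by (subst integral_nonneg_eq_0_iff_AE[OF int]) (auto simp: AE_measure_pmf_iff h)
  also have "\<dots> \<longleftrightarrow> (\<forall>z\<in>set_pmf J. pmf (map_pmf Y p) (snd z) - pmf J z = 0)"
  proof (intro ball_cong refl)
    fix z assume z: "z \<in> set_pmf J"
    then show "- ln (h z) = 0 \<longleftrightarrow> pmf (map_pmf Y p) (snd z) - pmf J z = 0"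
      using ln_eq_zero_iff[OF h(1)[OF z]] setJ[OF z] by (auto simp: h_def)
  qed
  \<comment> \<open>The gap between the mass of \<open>Y \<omega>\<close> and that of the pair is
    the probability of the same \<open>Y\<close> value with a different \<open>X\<close>
    value.\<close>
  also have "\<dots> \<longleftrightarrow> (\<forall>\<omega>\<in>set_pmf p. measure_pmf.prob p ({\<omega>'. Y \<omega>' = Y \<omega> \<and> X \<omega>' \<noteq> X \<omega>}) = 0)"
  proof -
    have "pmf (map_pmf Y p) (Y \<omega>) - pmf J (X \<omega>, Y \<omega>) = measure_pmf.prob p ({\<omega>'. Y \<omega>' = Y \<omega> \<and> X \<omega>' \<noteq> X \<omega>})" for \<omega>
      unfolding J_def pmf_map
      by (subst measure_pmf.finite_measure_Diff[symmetric]) (auto intro!: arg_cong[where f = "measure_pmf.prob p"])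
    moreover have "set_pmf J = (\<lambda>\<omega>. (X \<omega>, Y \<omega>)) ` set_pmf p"
      by (simp add: J_def)
    ultimately show ?thesis by (simp del: right_minus_eq)
  qed
  also have "\<dots> \<longleftrightarrow> (\<forall>\<omega>\<in>set_pmf p. \<forall>\<omega>'\<in>set_pmf p. Y \<omega> = Y \<omega>' \<longrightarrow> X \<omega> = X \<omega>')"
    by (auto simp: measure_pmf_zero_iff disjoint_iff)
  finally show ?thesis .
qed

section \<open>Bounds on the entropy, and auxiliary facts on conditioning and mixtures\<close>

text \<open>The information content \<open>- log 2 (g (X \<omega>))\<close> is at least
  \<open>h\<close> at every outcome in the support, hence so is its mean. Without finite entropy the
  value is infinite by definition.\<close>

lemma entropy_bits_ge:
  assumes le: "\<And>x. pmf (map_pmf X p) x \<le> 2 powr - h"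
  shows "ereal h \<le> entropy_bits p X"
proof -
  interpret information_space "pmf_space p" 2 by (rule information_space_pmf_space)
  define V where "V = X ` set_pmf p"
  define g where "g x = pmf (map_pmf X p) x" for x
  have D: "distributed (pmf_space p) (count_space V) X (\<lambda>x. ennreal (g x))"
    unfolding V_def g_def by (rule distributed_pmf_space) auto
  have g_nn: "g x \<ge> 0" for x by (simp add: g_def)
  have ge: "h \<le> entropy 2 (count_space V) X" if f: "finite_entropy (count_space V) X f" for f
  proof -
    \<comment> \<open>Densities are unique almost everywhere, and on a counting space this means
      everywhere, so any witness of finite entropy is the mass function itself.\<close>
    have "AE x in count_space V. ennreal (f x) = ennreal (g x)"
      using f D by (intro distributed_unique) (auto simp: finite_entropy_def)
    then have fg: "f x = g x" if "x \<in> V" for x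
      using that f g_nn[of x] by (auto simp: AE_count_space finite_entropy_def)
    have "integrable (count_space V) (\<lambda>x. f x * log 2 (f x))"
      using f by (simp add: finite_entropy_def)
    then have "integrable (count_space V) (\<lambda>x. g x * log 2 (g x))"
      by (subst (asm) Bochner_Integration.integrable_cong[OF refl, where g = "\<lambda>x. g x * log 2 (g x)"])
         (auto simp: fg)
    then have int: "integrable (pmf_space p) (\<lambda>\<omega>. - log 2 (g (X \<omega>)))"
      using distributed_integrable[OF D, of "\<lambda>x. log 2 (g x)"] g_nn by simp
    have "h \<le> (\<integral>\<omega>. - log 2 (g (X \<omega>)) \<partial>pmf_space p)"
    proof (rule integral_ge_const[OF int], rule AE_I2)
      fix \<omega> assume "\<omega> \<in> space (pmf_space p)"
      then have "g (X \<omega>) > 0" unfolding g_def by (intro pmf_positive) auto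
      moreover have "g (X \<omega>) \<le> 2 powr - h" using le by (simp add: g_def)
      ultimately show "h \<le> - log 2 (g (X \<omega>))"
        using log_le_cancel_iff[of 2 "g (X \<omega>)" "2 powr - h"] by simp
    qed
    also have "\<dots> = - (\<integral>x. g x * log 2 (g x) \<partial>count_space V)"
      using distributed_integral[OF D, of "\<lambda>x. log 2 (g x)"] g_nn by simp
    also have "\<dots> = entropy 2 (count_space V) X"
      using entropy_distr[OF D] g_nn by simp
    finally show ?thesis .
  qed
  then show ?thesis
    by (auto simp: entropy_bits_def Let_def V_def)
qed

lemma entropy_bits_le_log_card:
  assumes A: "finite A" "X ` set_pmf p \<subseteq> A"
  shows "entropy_bits p X \<le> ereal (log 2 (real (card A)))"
proof -
  interpret information_space "pmf_space p" 2 by (rule information_space_pmf_space)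
  have "finite (X ` set_pmf p)" using A by (rule finite_subset[rotated])
  then have sf: "simple_function (pmf_space p) X"
    by (simp add: simple_function_def)
  have "entropy 2 (count_space (X ` set_pmf p)) X \<le> log 2 (real (card (X ` set_pmf p)))"
    using entropy_le_card[OF simple_distributedI[OF sf _ refl]] by simp
  also have "\<dots> \<le> log 2 (real (card A))"
    using A card_mono[OF A] \<open>finite (X ` set_pmf p)\<close>
    by (subst log_le_cancel_iff) (auto simp: card_gt_0_iff set_pmf_not_empty)
  finally show ?thesis
    using finite_entropy_simple_function[OF sf] by (auto simp: entropy_bits_def Let_def)
qed

lemma cond_pmf_superset:
  assumes "set_pmf p \<subseteq> A"
  shows "cond_pmf p A = p"
proof (rule pmf_eqI)
  fix x
  have ne: "set_pmf p \<inter> A \<noteq> {}" using assms set_pmf_not_empty[of p] by blast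
  have 1: "measure_pmf.prob p A = 1"
    using assms by (auto simp: measure_pmf.prob_eq_1 AE_measure_pmf_iff)
  show "pmf (cond_pmf p A) x = pmf p x"
    using assms by (auto simp: pmf_cond[OF ne] 1 set_pmf_iff)
qed

lemma pmf_bind_le:
  assumes "\<And>x. x \<in> set_pmf p \<Longrightarrow> pmf (f x) a \<le> c"
  shows "pmf (bind_pmf p f) a \<le> c"
  unfolding pmf_bind
  using assms by (intro measure_pmf.integral_le_const measure_pmf.integrable_const_bound[where B = 1])
    (auto simp: AE_measure_pmf_iff pmf_le_1)

section \<open>Support of the model distribution\<close>

lemma finite_field_extD:
  assumes "finite_field_ext q l F k"
  shows "field F" "finite (carrier F)" "card (carrier F) = q ^ l" "finite k" "k \<subseteq> carrier F"
    "k - {\<zero>\<^bsub>F\<^esub>} \<noteq> {}" "q > 1" "l \<ge> 1"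
proof -
  show q: "q > 1" "l \<ge> 1" "card (carrier F) = q ^ l" "field F"
    using assms by (auto simp: finite_field_ext_def primepow_gt_Suc_0)
  then show "finite (carrier F)" by (intro card_ge_0_finite) simp
  have k: "card k = q" "subfield k F" using assms by (auto simp: finite_field_ext_def)
  show "finite k" using k q by (intro card_ge_0_finite) simp
  show "k \<subseteq> carrier F" using k(2) by (rule subfieldE(3))
  have "k \<noteq> {\<zero>\<^bsub>F\<^esub>}" "k \<noteq> {}" using k q by auto
  then show "k - {\<zero>\<^bsub>F\<^esub>} \<noteq> {}" by blast
qed

lemma finite_support_set: "S \<in> support_sets K M \<Longrightarrow> finite S"
  unfolding support_sets_def using finite_subset[of S "{1..K}"] by simp

lemma finite_support_sets: "finite (support_sets K M)"
  by (rule finite_subset[of _ "Pow {1..K}"]) (auto simp: support_sets_def)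

lemma support_sets_nonempty:
  assumes "M < K" "i \<in> {1..K}"
  obtains S where "S \<in> support_sets K M" "i \<notin> S"
proof -
  have "M \<le> card ({1..K} - {i})" using assms by simp
  then obtain S where "S \<subseteq> {1..K} - {i}" "card S = M"
    by (meson obtain_subset_with_card_n)
  then show ?thesis by (intro that[of S]) (auto simp: support_sets_def)
qed

lemma card_diff_support_set:
  assumes "S \<in> support_sets K M"
  shows "card ({1..K} - S) = K - M"
  using assms by (subst card_Diff_subset) (auto simp: support_sets_def intro: finite_subset)

lemma set_pmf_Supp:
  assumes "M < K"
  shows "set_pmf (pmf_of_set (support_sets K M)) = support_sets K M"
  using support_sets_nonempty[OF assms, of 1] assms finite_support_sets by (intro set_pmf_of_set) auto

lemma set_pmf_Demand:
  assumes "M < K" "S \<in> support_sets K M"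
  shows "set_pmf (pmf_of_set ({1..K} - S)) = {1..K} - S"
proof (rule set_pmf_of_set)
  have "card ({1..K} - S) > 0" using card_diff_support_set[OF assms(2)] assms(1) by simp
  then show "{1..K} - S \<noteq> {}" by (metis card.empty less_irrefl)
qed simp

lemma finite_coeff_seqs:
  assumes "finite_field_ext q l F k"
  shows "finite (coeff_seqs M F k)" "coeff_seqs M F k \<noteq> {}"
proof -
  note k = finite_field_extD[OF assms]
  have "finite {C. set C \<subseteq> k - {\<zero>\<^bsub>F\<^esub>} \<and> length C = M}"
    using k by (intro finite_lists_length_eq) simp
  then show "finite (coeff_seqs M F k)" by (simp add: coeff_seqs_def conj_commute)
  obtain c where "c \<in> k - {\<zero>\<^bsub>F\<^esub>}" using k by blast
  then have "replicate M c \<in> coeff_seqs M F k" by (auto simp: coeff_seqs_def)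
  then show "coeff_seqs M F k \<noteq> {}" by blast
qed

lemma finite_message_tuples:
  assumes "finite_field_ext q l F k"
  shows "finite (message_tuples K F)" "message_tuples K F \<noteq> {}"
    "card (message_tuples K F) = (q ^ l) ^ K"
  using finite_field_extD[OF assms]
  by (auto simp: message_tuples_def card_PiE PiE_eq_empty_iff finite_PiE)

lemma set_pmf_model_I:
  assumes F: "finite_field_ext q l F k" and MK: "M < K"
  shows "\<omega> \<in> set_pmf (model_I K M F k query) \<longleftrightarrow>
    Supp \<omega> \<in> support_sets K M \<and> Demand \<omega> \<in> {1..K} - Supp \<omega> \<and> Coeffs \<omega> \<in> coeff_seqs M F k \<and>
    Msgs \<omega> \<in> message_tuples K F \<and> Query \<omega> \<in> set_pmf (query (Demand \<omega>) (Supp \<omega>) (Coeffs \<omega>))"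
proof -
  show ?thesis
    unfolding model_I_def set_bind_pmf set_return_pmf set_pmf_Supp[OF MK]
    using finite_coeff_seqs[OF F, of M] finite_message_tuples[OF F, of K]
    by (cases \<omega>) (auto simp: set_pmf_Demand[OF MK, simplified])
qed

lemma not_demand_in_supp:
  assumes "finite_field_ext q l F k" "M < K" "\<omega> \<in> set_pmf (model_I K M F k query)"
  shows "\<not> demand_in_supp \<omega>"
  using assms by (auto simp: set_pmf_model_I demand_in_supp_def)

section \<open>The converse\<close>

text \<open>Greedily collect indices \<open>i\<close> outside the set \<open>T\<close> determined so far; each costs at most
  \<open>M + 1\<close> new elements of \<open>T\<close>.\<close>

lemma determined_coordinates:
  fixes \<Phi> :: "(nat \<Rightarrow> 'f) set"
  assumes dep: "\<forall>i\<in>{1..K}. \<exists>S \<subseteq> {1..K}. card S = M \<and> i \<notin> S \<and>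
      (\<forall>X\<in>\<Phi>. \<forall>X'\<in>\<Phi>. (\<forall>s\<in>S. X s = X' s) \<longrightarrow> X i = X' i)"
    and j: "j * (M + 1) < K + (M + 1)"
  shows "\<exists>I T. I \<subseteq> T \<and> T \<subseteq> {1..K} \<and> card I = j \<and> card T \<le> j * (M + 1) \<and>
      (\<forall>X\<in>\<Phi>. \<forall>X'\<in>\<Phi>. (\<forall>t\<in>T - I. X t = X' t) \<longrightarrow> (\<forall>t\<in>T. X t = X' t))"
  using j
proof (induction j)
  case 0
  show ?case by (intro exI[of _ "{}"]) auto
next
  case (Suc j)
  from Suc.prems have "j * (M + 1) < K + (M + 1)" by simp
  from Suc.IH[OF this]
  obtain I T where IT: "I \<subseteq> T" "T \<subseteq> {1..K}" "card I = j" "card T \<le> j * (M + 1)"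
    and det: "\<forall>X\<in>\<Phi>. \<forall>X'\<in>\<Phi>. (\<forall>t\<in>T - I. X t = X' t) \<longrightarrow> (\<forall>t\<in>T. X t = X' t)"
    by (elim exE conjE)
  have fin: "finite T" using IT(2) by (rule finite_subset) simp
  have finI: "finite I" using IT(1) fin by (rule finite_subset)
  \<comment> \<open>The bound on \<open>Suc j\<close> leaves \<open>j * (M + 1) < K\<close>, so some
    index is still outside \<open>T\<close>.\<close>
  have "card T < card {1..K}" using IT Suc.prems by simp
  with IT obtain i where i: "i \<in> {1..K}" "i \<notin> T"
    by (metis card_subset_eq finite_atLeastAtMost less_irrefl subsetI subset_antisym)
  from bspec[OF dep i(1)] obtain S where S: "S \<subseteq> {1..K}" "card S = M" "i \<notin> S"
    and rec: "\<forall>X\<in>\<Phi>. \<forall>X'\<in>\<Phi>. (\<forall>s\<in>S. X s = X' s) \<longrightarrow> X i = X' i"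
    by (elim exE conjE)
  have finS: "finite S" using S(1) by (rule finite_subset) simp
  show ?case
  proof (intro exI conjI ballI impI)
    show "insert i I \<subseteq> insert i (T \<union> S)" "insert i (T \<union> S) \<subseteq> {1..K}"
      using IT i S by auto
    show "card (insert i I) = Suc j" using i IT finI by (subst card_insert_disjoint) auto
    have "card (insert i (T \<union> S)) \<le> Suc (card T + card S)"
      using card_Un_le[of T S] fin finS by (simp add: card_insert_if)
    then show "card (insert i (T \<union> S)) \<le> Suc j * (M + 1)" using IT S by simp
    fix X X' t
    assume X: "X \<in> \<Phi>" "X' \<in> \<Phi>" and eq: "\<forall>t\<in>insert i (T \<union> S) - insert i I. X t = X' t"
      and t: "t \<in> insert i (T \<union> S)"
    have T: "\<forall>t\<in>T. X t = X' t" by (rule det[THEN bspec, THEN bspec, THEN mp, OF X]) (use eq i in auto)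
    \<comment> \<open>An element of \<open>S\<close> outside \<open>T\<close> is neither
      \<open>i\<close> nor in \<open>I\<close>, so agreement there is assumed; inside
      \<open>T\<close> it is already known. Agreement on \<open>S\<close> then yields agreement at
      \<open>i\<close>.\<close>
    have S': "\<forall>t\<in>S. X t = X' t" 
    proof
      fix s assume "s \<in> S"
      with eq T S IT show "X s = X' s" by (cases "s \<in> T") auto
    qed
    then show "X t = X' t" using t T rec[rule_format, OF X] by auto
  qed
qed

text \<open>Forgetting the \<open>j\<close> coordinates in \<open>I\<close> is injective on
  \<open>\<Phi>\<close>, because they are determined by the others. The bound on \<open>j\<close>
  says that it is at most the ceiling of K / (M + 1); the product form of the conclusion avoids the
  exponent \<open>K - j\<close>.\<close>

lemma card_determined_le:
  fixes \<Phi> :: "(nat \<Rightarrow> 'f) set"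
  assumes dep: "\<forall>i\<in>{1..K}. \<exists>S \<subseteq> {1..K}. card S = M \<and> i \<notin> S \<and>
      (\<forall>X\<in>\<Phi>. \<forall>X'\<in>\<Phi>. (\<forall>s\<in>S. X s = X' s) \<longrightarrow> X i = X' i)"
    and j: "j * (M + 1) < K + (M + 1)"
    and \<Phi>: "\<Phi> \<subseteq> {1..K} \<rightarrow>\<^sub>E A" and A: "finite A"
  shows "card \<Phi> * card A ^ j \<le> card A ^ K"
proof -
  obtain I T where IT: "I \<subseteq> T" "T \<subseteq> {1..K}" "card I = j"
    and det: "\<forall>X\<in>\<Phi>. \<forall>X'\<in>\<Phi>. (\<forall>t\<in>T - I. X t = X' t) \<longrightarrow> (\<forall>t\<in>T. X t = X' t)"
    using determined_coordinates[OF dep j] by (elim exE conjE)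
  have I: "I \<subseteq> {1..K}" using IT by simp
  then have finI: "finite I" by (rule finite_subset) simp
  have jK: "j \<le> K" using card_mono[OF _ I] IT by simp
  define R where "R = ({1..K} - I) \<rightarrow>\<^sub>E A"
  have R: "finite R" "card R = card A ^ (K - j)"
    using A I finI IT by (auto simp: R_def card_PiE card_Diff_subset intro!: finite_PiE)
  have "inj_on (\<lambda>X. restrict X ({1..K} - I)) \<Phi>"
  proof (rule inj_onI)
    fix X X' assume X: "X \<in> \<Phi>" "X' \<in> \<Phi>"
      and eq: "restrict X ({1..K} - I) = restrict X' ({1..K} - I)"
    have off: "X t = X' t" if "t \<in> {1..K} - I" for t
      using fun_cong[OF eq, of t] that by simp
    have T: "\<forall>t\<in>T. X t = X' t" by (rule det[THEN bspec, THEN bspec, THEN mp, OF X]) (use off IT in auto)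
    show "X = X'"
    proof (rule PiE_ext)
      show "X \<in> {1..K} \<rightarrow>\<^sub>E A" "X' \<in> {1..K} \<rightarrow>\<^sub>E A" using X \<Phi> by auto
      fix t assume "t \<in> {1..K}"
      then show "X t = X' t" using off T IT by (cases "t \<in> T") auto
    qed
  qed
  moreover have "(\<lambda>X. restrict X ({1..K} - I)) ` \<Phi> \<subseteq> R"
  proof (rule image_subsetI)
    fix X assume "X \<in> \<Phi>"
    with \<Phi> have "X \<in> {1..K} \<rightarrow>\<^sub>E A" by (rule subsetD)
    from PiE_mem[OF this] show "restrict X ({1..K} - I) \<in> R"
      by (simp add: R_def restrict_PiE_iff)
  qed
  ultimately have "card \<Phi> \<le> card A ^ (K - j)"
    using R card_inj_on_le by metis
  then have "card \<Phi> * card A ^ j \<le> card A ^ (K - j) * card A ^ j" by simp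
  also have "\<dots> = card A ^ K" using jK by (simp flip: power_add)
  finally show ?thesis .
qed

section \<open>Privacy and recoverability as conditions on the support\<close>

lemma side_info_cong:
  assumes F: "finite_field_ext q l F k" and S: "S \<in> support_sets K M"
    and C: "C \<in> coeff_seqs M F k" and X: "X \<in> message_tuples K F" "X' \<in> message_tuples K F"
    and eq: "\<And>s. s \<in> S \<Longrightarrow> X s = X' s"
  shows "side_info F S C X = side_info F S C X'"
proof -
  interpret field F using finite_field_extD[OF F] by simp
  have finS: "finite S" using S by (rule finite_support_set)
  have nth: "sorted_list_of_set S ! j \<in> S" if "j < card S" for j
    using nth_mem[of j "sorted_list_of_set S"] that finS by simp
  have "C ! j \<in> carrier F" if "j < card S" for j
  proof -
    have "C ! j \<in> set C" using that C S by (intro nth_mem) (auto simp: coeff_seqs_def support_sets_def)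
    then show ?thesis using C finite_field_extD(5)[OF F] by (auto simp: coeff_seqs_def)
  qed
  moreover have "X' (sorted_list_of_set S ! j) \<in> carrier F" if "j < card S" for j
    using nth[OF that] S X by (auto simp: support_sets_def message_tuples_def PiE_def Pi_def)
  ultimately show ?thesis
    unfolding side_info_def by (intro finsum_cong') (auto simp: eq nth)
qed

lemma finite_Demand_model_I:
  assumes "finite_field_ext q l F k" "M < K"
  shows "finite (Demand ` set_pmf (model_I K M F k query))"
  by (rule finite_subset[of _ "{1..K}"]) (auto simp: set_pmf_model_I[OF assms])

text \<open>In Model I the indicator is constantly \<open>False\<close>, and the demand has finitely
  many values, so conditional privacy is plain independence.\<close>

lemma W_private_model_I_iff:
  fixes query :: "('f, 'q) query_kernel"
  assumes "finite_field_ext q l F k" "M < K"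
  defines "p \<equiv> model_I K M F k query"
  shows "W_private p \<longleftrightarrow>
    map_pmf (\<lambda>\<omega>. (Demand \<omega>, Query \<omega>)) p = pair_pmf (map_pmf Demand p) (map_pmf Query p)"
  unfolding W_private_def p_def
  by (rule cond_mutual_info_bits_eq_0_iff[where c = False])
     (use finite_Demand_model_I[OF assms(1,2)] not_demand_in_supp[OF assms(1,2)] in auto)

text \<open>The query is drawn independently of the messages, so replacing the message tuple of a
  possible outcome gives another possible outcome. Hence the outcomes to be compared run over all
  message tuples, with demand, support, coefficients and query fixed.\<close>

lemma recoverable_model_I_iff:
  fixes query :: "('f, 'q) query_kernel"
  assumes F: "finite_field_ext q l F k" and MK: "M < K"
  defines "p \<equiv> model_I K M F k query"
  shows "recoverable F p answer \<longleftrightarrow>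
    (\<forall>\<omega>\<in>set_pmf p. \<forall>X\<in>message_tuples K F.
      answer (Query \<omega>) False X = answer (Query \<omega>) False (Msgs \<omega>) \<and>
      side_info F (Supp \<omega>) (Coeffs \<omega>) X = side_info F (Supp \<omega>) (Coeffs \<omega>) (Msgs \<omega>) \<longrightarrow>
      X (Demand \<omega>) = Msgs \<omega> (Demand \<omega>))" (is "?L \<longleftrightarrow> ?R")
proof -
  note set = set_pmf_model_I[OF F MK]
  have fin: "finite ((\<lambda>\<omega>. Msgs \<omega> (Demand \<omega>)) ` set_pmf p)"
  proof (rule finite_subset)
    show "(\<lambda>\<omega>. Msgs \<omega> (Demand \<omega>)) ` set_pmf p \<subseteq> carrier F"
    proof (rule image_subsetI)
      fix \<omega> assume "\<omega> \<in> set_pmf p"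
      then have "Msgs \<omega> \<in> {1..K} \<rightarrow>\<^sub>E carrier F" "Demand \<omega> \<in> {1..K}"
        by (simp_all add: p_def set message_tuples_def)
      then show "Msgs \<omega> (Demand \<omega>) \<in> carrier F" by (rule PiE_mem)
    qed
  qed (rule finite_field_extD(2)[OF F])
  note iff = cond_entropy_bits_eq_0_iff[OF fin]
  show ?thesis
  proof
    assume L: ?L
    show ?R
    proof (intro ballI impI)
      fix \<omega> X assume \<omega>: "\<omega> \<in> set_pmf p" and X: "X \<in> message_tuples K F"
        and eq: "answer (Query \<omega>) False X = answer (Query \<omega>) False (Msgs \<omega>) \<and>
          side_info F (Supp \<omega>) (Coeffs \<omega>) X = side_info F (Supp \<omega>) (Coeffs \<omega>) (Msgs \<omega>)"
      have \<omega>': "\<omega>\<lparr>Msgs := X\<rparr> \<in> set_pmf p" using \<omega> X by (simp add: p_def set)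
      show "X (Demand \<omega>) = Msgs \<omega> (Demand \<omega>)"
        using L[unfolded recoverable_def iff, rule_format, OF \<omega>' \<omega>] eq \<omega>
          not_demand_in_supp[OF F MK \<omega>[unfolded p_def]] not_demand_in_supp[OF F MK \<omega>'[unfolded p_def]]
        by (simp add: Answer_def)
    qed
  next
    assume R: ?R
    show ?L unfolding recoverable_def iff
    proof (intro ballI impI)
      fix \<omega> \<omega>' assume \<omega>: "\<omega> \<in> set_pmf p" "\<omega>' \<in> set_pmf p"
        and eq: "(Answer answer \<omega>, Query \<omega>, demand_in_supp \<omega>,
             side_info F (Supp \<omega>) (Coeffs \<omega>) (Msgs \<omega>), Demand \<omega>, Supp \<omega>, Coeffs \<omega>) =
           (Answer answer \<omega>', Query \<omega>', demand_in_supp \<omega>',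
             side_info F (Supp \<omega>') (Coeffs \<omega>') (Msgs \<omega>'), Demand \<omega>', Supp \<omega>', Coeffs \<omega>')"
      have "Msgs \<omega> \<in> message_tuples K F" using \<omega> by (simp add: p_def set)
      then show "Msgs \<omega> (Demand \<omega>) = Msgs \<omega>' (Demand \<omega>')"
        using R[rule_format, OF \<omega>(2), of "Msgs \<omega>"] eq
          not_demand_in_supp[OF F MK \<omega>(1)[unfolded p_def]] not_demand_in_supp[OF F MK \<omega>(2)[unfolded p_def]]
        by (auto simp: Answer_def)
    qed
  qed
qed

text \<open>Every demand has positive probability, so by independence \<open>Q\<close> also occurs
  together with demand \<open>i\<close>. The support set of such an outcome is the required
  \<open>S\<close>: messages that agree on it have the same side information, and recoverability
  then fixes \<open>X i\<close>.\<close>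

lemma query_determines_message:
  assumes F: "finite_field_ext q l F k" and MK: "M < K"
    and pir: "pir_csi_I K M F k query answer"
    and Q: "Q \<in> Query ` set_pmf (model_I K M F k query)" and i: "i \<in> {1..K}"
  shows "\<exists>S \<subseteq> {1..K}. card S = M \<and> i \<notin> S \<and>
    (\<forall>X\<in>message_tuples K F. \<forall>X'\<in>message_tuples K F.
      answer Q False X = answer Q False X' \<longrightarrow> (\<forall>s\<in>S. X s = X' s) \<longrightarrow> X i = X' i)"
proof -
  define p where "p = model_I K M F k query"
  note set = set_pmf_model_I[OF F MK]
  have J: "map_pmf (\<lambda>\<omega>. (Demand \<omega>, Query \<omega>)) p = pair_pmf (map_pmf Demand p) (map_pmf Query p)"
    using pir W_private_model_I_iff[OF F MK, of query] by (simp add: pir_csi_I_def p_def)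
  have "i \<in> Demand ` set_pmf p"
  proof -
    obtain S where S: "S \<in> support_sets K M" "i \<notin> S" using support_sets_nonempty[OF MK i] .
    obtain C where C: "C \<in> coeff_seqs M F k" using finite_coeff_seqs[OF F] by blast
    obtain X where X: "X \<in> message_tuples K F" using finite_message_tuples[OF F] by blast
    obtain Q where "Q \<in> set_pmf (query i S C)" using set_pmf_not_empty[of "query i S C"] by blast
    then have "\<lparr>Demand = i, Supp = S, Coeffs = C, Msgs = X, Query = Q\<rparr> \<in> set_pmf p"
      using S C X i by (simp add: p_def set)
    from imageI[OF this, of Demand] show ?thesis by simp
  qed
  with Q have "(i, Q) \<in> set_pmf (map_pmf (\<lambda>\<omega>. (Demand \<omega>, Query \<omega>)) p)"
    unfolding J by (simp add: p_def)
  then obtain \<omega> where \<omega>: "\<omega> \<in> set_pmf p" "Demand \<omega> = i" "Query \<omega> = Q" by auto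
  then have \<omega>': "Supp \<omega> \<in> support_sets K M" "i \<notin> Supp \<omega>" "Coeffs \<omega> \<in> coeff_seqs M F k"
    by (auto simp: p_def set)
  have rec: "recoverable F p answer" using pir by (simp add: pir_csi_I_def p_def)
  show ?thesis
  proof (intro exI[of _ "Supp \<omega>"] conjI ballI impI)
    show "Supp \<omega> \<subseteq> {1..K}" "card (Supp \<omega>) = M" using \<omega>' by (auto simp: support_sets_def)
    fix X X' assume X: "X \<in> message_tuples K F" "X' \<in> message_tuples K F"
      and a: "answer Q False X = answer Q False X'" and S: "\<forall>s\<in>Supp \<omega>. X s = X' s"
    have "\<omega>\<lparr>Msgs := X'\<rparr> \<in> set_pmf p" using \<omega>(1) X by (simp add: p_def set)
    from rec[unfolded p_def recoverable_model_I_iff[OF F MK], folded p_def, rule_format, OF this X(1)]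
      a \<omega> side_info_cong[OF F \<omega>'(1,3) X] S
    show "X i = X' i" by simp
  qed fact
qed

section \<open>From fibre sizes to entropy and rate\<close>

text \<open>Given the query the messages are still uniform, so an answer has probability
  proportional to the size \<open>card \<Phi>\<close> of its fibre, which
  \<open>card_determined_le\<close> bounds. The bound is the same for all queries and so survives
  averaging over them.\<close>

lemma pmf_Answer_le:
  assumes F: "finite_field_ext q l F k" and MK: "M < K"
    and pir: "pir_csi_I K M F k query answer" and n: "n * (M + 1) < K + (M + 1)"
  shows "pmf (map_pmf (Answer answer) (model_I K M F k query)) a \<le> 1 / real ((q ^ l) ^ n)"
proof -
  note set = set_pmf_model_I[OF F MK]
  have fibre: "pmf (map_pmf (answer Q False) (pmf_of_set (message_tuples K F))) a \<le> 1 / real ((q ^ l) ^ n)"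
    if Q: "Q \<in> Query ` set_pmf (model_I K M F k query)" for Q
  proof -
    define \<Phi> where "\<Phi> = {X \<in> message_tuples K F. answer Q False X = a}"
    have "card \<Phi> * card (carrier F) ^ n \<le> card (carrier F) ^ K"
    proof (rule card_determined_le[OF ballI n])
      show "\<exists>S\<subseteq>{1..K}. card S = M \<and> i \<notin> S \<and>
          (\<forall>X\<in>\<Phi>. \<forall>X'\<in>\<Phi>. (\<forall>s\<in>S. X s = X' s) \<longrightarrow> X i = X' i)" if i: "i \<in> {1..K}" for i
      proof -
        obtain S where S: "S \<subseteq> {1..K}" "card S = M" "i \<notin> S"
          and rec: "\<forall>X\<in>message_tuples K F. \<forall>X'\<in>message_tuples K F.
            answer Q False X = answer Q False X' \<longrightarrow> (\<forall>s\<in>S. X s = X' s) \<longrightarrow> X i = X' i"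
          using query_determines_message[OF F MK pir Q i] by (elim exE conjE)
        have "\<forall>X\<in>\<Phi>. \<forall>X'\<in>\<Phi>. (\<forall>s\<in>S. X s = X' s) \<longrightarrow> X i = X' i"
          using rec by (simp add: \<Phi>_def)
        with S show ?thesis by (intro exI[of _ S] conjI)
      qed
    qed (auto simp: \<Phi>_def message_tuples_def finite_field_extD(2)[OF F])
    then have "real (card \<Phi> * (q ^ l) ^ n) \<le> real ((q ^ l) ^ K)"
      using finite_field_extD[OF F] by (simp only: of_nat_le_iff)
    then have "real (card \<Phi>) / real ((q ^ l) ^ K) \<le> 1 / real ((q ^ l) ^ n)"
      using finite_field_extD(7)[OF F] by (simp add: divide_simps)
    moreover have "pmf (map_pmf (answer Q False) (pmf_of_set (message_tuples K F))) a = real (card \<Phi>) / real ((q ^ l) ^ K)"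
      using finite_message_tuples[OF F, of K]
      by (auto simp: pmf_map measure_pmf_of_set \<Phi>_def intro!: arg_cong[where f = card] arg_cong2[where f = "(/)"])
    ultimately show ?thesis by simp
  qed
  \<comment> \<open>The messages and the query are drawn independently, so the query may be drawn
    first; the answer is then a mixture of the laws treated in \<open>fibre\<close>.\<close>
  have swap: "bind_pmf (pmf_of_set (message_tuples K F)) (\<lambda>X. bind_pmf (query W S C)
       (\<lambda>Q. return_pmf (answer Q (W \<in> S) X))) =
     bind_pmf (query W S C) (\<lambda>Q. map_pmf (answer Q (W \<in> S)) (pmf_of_set (message_tuples K F)))" for W S C
    by (subst bind_commute_pmf) (simp add: map_pmf_def)
  have SW: "S \<in> support_sets K M" if "S \<in> set_pmf (pmf_of_set (support_sets K M))" for S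
    using that by (simp add: set_pmf_Supp[OF MK])
  have WS: "W \<in> {1..K} - S" if "W \<in> set_pmf (pmf_of_set ({1..K} - S))" "S \<in> support_sets K M" for S W
    using that(1) unfolding set_pmf_Demand[OF MK that(2)] .
  show ?thesis
    unfolding model_I_def map_bind_pmf map_return_pmf Answer_def demand_in_supp_def outcome.simps swap
  proof (intro pmf_bind_le)
    fix S W C Q
    assume *: "S \<in> set_pmf (pmf_of_set (support_sets K M))" "W \<in> set_pmf (pmf_of_set ({1..K} - S))"
      "C \<in> set_pmf (pmf_of_set (coeff_seqs M F k))" "Q \<in> set_pmf (query W S C)"
    obtain X where X: "X \<in> message_tuples K F" using finite_message_tuples[OF F] by blast
    have "\<lparr>Demand = W, Supp = S, Coeffs = C, Msgs = X, Query = Q\<rparr> \<in> set_pmf (model_I K M F k query)"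
      using SW[OF *(1)] WS[OF *(2) SW[OF *(1)]] * X finite_coeff_seqs[OF F, of M] by (simp add: set)
    then have "Q \<in> Query ` set_pmf (model_I K M F k query)" by (rule image_eqI[rotated]) simp
    from fibre[OF this] show "pmf (map_pmf (answer Q (W \<in> S)) (pmf_of_set (message_tuples K F))) a \<le> 1 / real ((q ^ l) ^ n)"
      using WS[OF *(2) SW[OF *(1)]] by simp
  qed
qed

lemma entropy_Answer_ge:
  assumes F: "finite_field_ext q l F k" and MK: "M < K"
    and pir: "pir_csi_I K M F k query answer" and n: "n * (M + 1) < K + (M + 1)"
  shows "ereal (real n * (real l * log 2 (real q))) \<le> entropy_bits (model_I K M F k query) (Answer answer)"
proof (rule entropy_bits_ge)
  have q: "real q > 0" using finite_field_extD[OF F] by simp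
  have "2 powr (real n * (real l * log 2 (real q))) = (2 powr log 2 (real q)) powr (real (l * n))"
    unfolding powr_powr by (simp add: mult_ac)
  also have "\<dots> = real ((q ^ l) ^ n)" using q by (simp add: powr_realpow power_mult del: of_nat_mult)
  finally show "pmf (map_pmf (Answer answer) (model_I K M F k query)) a
      \<le> 2 powr - (real n * (real l * log 2 (real q)))" for a
    using pmf_Answer_le[OF assms, of a] by (simp add: powr_minus divide_inverse)
qed

lemma rate_eq:
  assumes "finite_field_ext q l F k" "M < K"
  shows "rate K M q l F k query answer =
    ereal (real l * log 2 (real q)) / entropy_bits (model_I K M F k query) (Answer answer)"
  unfolding rate_def
  by (subst cond_pmf_superset) (use not_demand_in_supp[OF assms] in auto)

lemma rate_le:
  assumes F: "finite_field_ext q l F k" and MK: "M < K"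
    and pir: "pir_csi_I K M F k query answer"
    and n: "n * (M + 1) < K + (M + 1)" "n > 0"
  shows "rate K M q l F k query answer \<le> ereal (1 / real n)"
proof -
  define L where "L = real l * log 2 (real q)"
  have "L > 0" using finite_field_extD[OF F] by (auto simp: L_def)
  then have nL: "0 < real n * L" using n(2) by simp
  have ge: "ereal (real n * L) \<le> entropy_bits (model_I K M F k query) (Answer answer)"
    unfolding L_def by (rule entropy_Answer_ge[OF F MK pir n(1)])
  show ?thesis
  proof (cases "entropy_bits (model_I K M F k query) (Answer answer)")
    case (real r)
    then have "real n * L \<le> r" using ge by simp
    then have "L / r \<le> 1 / real n" using nL n(2) by (simp add: field_simps)
    then show ?thesis using nL \<open>real n * L \<le> r\<close> by (simp add: rate_eq[OF F MK] real flip: L_def)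
  \<comment> \<open>An infinite entropy gives rate 0, and the lower bound excludes entropy minus
    infinity.\<close>
  qed (use ge in \<open>simp_all add: rate_eq[OF F MK] flip: L_def\<close>)
qed

section \<open>The field with two elements\<close>

text \<open>Built on natural numbers because the capacities range over fields of type
  \<open>nat ring\<close>. Products of 0 and 1 stay in the carrier, so only addition is reduced
  modulo 2.\<close>

definition gf2 :: "nat ring" where
  "gf2 = \<lparr>carrier = {0, 1}, mult = (*), one = 1, zero = 0, add = (\<lambda>x y. (x + y) mod 2)\<rparr>"

lemma carrier_gf2: "carrier gf2 = {0, 1}"
  by (simp add: gf2_def)

lemma gf2_simps [simp]:
  "x \<otimes>\<^bsub>gf2\<^esub> y = x * y" "\<one>\<^bsub>gf2\<^esub> = 1" "\<zero>\<^bsub>gf2\<^esub> = 0"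
  "x \<oplus>\<^bsub>gf2\<^esub> y = (x + y) mod 2"
  by (simp_all add: gf2_def)

lemma field_gf2: "field gf2"
proof -
  have "cring gf2"
  proof (rule cringI)
    show "abelian_group gf2"
      by (rule abelian_groupI) (auto simp: carrier_gf2)
    show "comm_monoid gf2"
      by (rule comm_monoidI) (auto simp: carrier_gf2)
  qed (auto simp: carrier_gf2)
  then interpret cring gf2 .
  have "Units gf2 = {1}" by (auto simp: Units_def carrier_gf2)
  then show ?thesis by (intro cring_fieldI) (auto simp: carrier_gf2)
qed

lemma finite_field_ext_gf2: "finite_field_ext 2 1 gf2 (carrier gf2)"
  using field.carrier_is_subfield[OF field_gf2] field_gf2
  by (simp add: finite_field_ext_def carrier_gf2)

text \<open>Turns field sums into ordinary sums, so that decoding becomes a parity argument.\<close>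

lemma finsum_gf2:
  assumes "finite A" "\<And>i. i \<in> A \<Longrightarrow> f i \<in> {0, 1}"
  shows "(\<Oplus>\<^bsub>gf2\<^esub>i\<in>A. f i) = (\<Sum>i\<in>A. f i) mod 2"
proof -
  interpret field gf2 by (rule field_gf2)
  show ?thesis using assms
  proof (induction A rule: finite_induct)
    case (insert x A)
    have "f \<in> A \<rightarrow> carrier gf2" "f x \<in> carrier gf2" using insert.prems by (auto simp: carrier_gf2)
    then show ?case using insert by (simp add: finsum_insert mod_add_right_eq)
  qed simp
qed

section \<open>The partition-and-code protocol\<close>

text \<open>Applied in both directions, the inequality makes the mass constant on \<open>A\<close>,
  and the total mass 1 fixes the constant. The one-sided form suits symmetry arguments.\<close>

lemma pmf_of_setI:
  assumes A: "finite A" "set_pmf p \<subseteq> A" and eq: "\<And>x y. x \<in> A \<Longrightarrow> y \<in> A \<Longrightarrow> pmf p x \<le> pmf p y"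
  shows "p = pmf_of_set A"
proof (rule pmf_eqI)
  fix x
  have ne: "A \<noteq> {}" using A set_pmf_not_empty[of p] by auto
  show "pmf p x = pmf (pmf_of_set A) x"
  proof (cases "x \<in> A")
    case True
    have "1 = (\<Sum>y\<in>A. pmf p y)" using sum_pmf_eq_1[OF A] by simp
    also have "\<dots> = (\<Sum>y\<in>A. pmf p x)" by (intro sum.cong refl antisym eq True)
    finally show ?thesis using True A ne by (simp add: field_simps)
  next
    case False
    then show ?thesis using A ne by (auto simp: set_pmf_iff)
  qed
qed

text \<open>Glues bijections between the two points, the two sets and the two remainders, the latter
  having equal size. This gives transitivity of relabellings on demand-support pairs.\<close>

lemma ex_bij_betw_extending:
  assumes K: "finite (A :: 'a set)" and S: "S \<subseteq> A" "S' \<subseteq> A" "card S = card S'"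
    and W: "W \<in> A - S" "W' \<in> A - S'"
  obtains \<tau> where "bij_betw \<tau> A A" "\<tau> W = W'" "\<tau> ` S = S'"
proof -
  have fin: "finite S" "finite S'" using S K by (auto intro: finite_subset)
  obtain f where f: "bij_betw f S S'" using finite_same_card_bij[OF fin S(3)] by blast
  have "card (A - insert W S) = card (A - insert W' S')"
    using S W fin by (subst (1 2) card_Diff_subset) auto
  then obtain g where g: "bij_betw g (A - insert W S) (A - insert W' S')"
    using finite_same_card_bij[of "A - insert W S" "A - insert W' S'"] K by blast
  define \<tau> where "\<tau> x = (if x = W then W' else if x \<in> S then f x else g x)" for x
  have 1: "bij_betw \<tau> S S'"
    using f W by (subst bij_betw_cong[of S \<tau> f]) (auto simp: \<tau>_def)
  have 2: "bij_betw \<tau> (A - insert W S) (A - insert W' S')"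
    using g by (subst bij_betw_cong[of _ \<tau> g]) (auto simp: \<tau>_def)
  have 3: "bij_betw \<tau> {W} {W'}" by (simp add: \<tau>_def)
  have "bij_betw \<tau> ({W} \<union> S \<union> (A - insert W S)) ({W'} \<union> S' \<union> (A - insert W' S'))"
    using W by (intro bij_betw_combine[OF bij_betw_combine[OF 3 1] 2]) auto
  moreover have "{W} \<union> S \<union> (A - insert W S) = A" "{W'} \<union> S' \<union> (A - insert W' S') = A"
    using S W by auto
  ultimately show ?thesis
    using that[of \<tau>] bij_betw_imp_surj_on[OF 1] by (simp add: \<tau>_def)
qed

text \<open>The ceiling of K / (M + 1), in natural-number arithmetic.\<close>

definition num_blocks :: "nat \<Rightarrow> nat \<Rightarrow> nat" where
  "num_blocks K M = (K + M) div (M + 1)"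

text \<open>The blocks have size exactly \<open>M + 1\<close> and cover \<open>{..<K}\<close>; if \<open>M + 1\<close> does not divide
  \<open>K\<close>, the last one is shifted to the left and overlaps its predecessor.\<close>

definition block :: "nat \<Rightarrow> nat \<Rightarrow> nat \<Rightarrow> nat set" where
  "block K M j = (let s = min (j * (M + 1)) (K - (M + 1)) in {s..<s + (M + 1)})"

text \<open>A position in the overlap of the last two blocks lies in both; the quotient selects one
  of them.\<close>

definition block_of :: "nat \<Rightarrow> nat \<Rightarrow> nat \<Rightarrow> nat set" where
  "block_of K M w = block K M (w div (M + 1))"

text \<open>The demand and the support to which the ordering \<open>xs\<close> corresponds when the
  demand sits at position \<open>w\<close>.\<close>

definition split_block :: "nat \<Rightarrow> nat \<Rightarrow> nat \<Rightarrow> nat list \<Rightarrow> nat \<times> nat set" where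
  "split_block K M w xs = (xs ! w, (!) xs ` (block_of K M w - {w}))"

definition orderings :: "nat \<Rightarrow> nat list pmf" where
  "orderings K = pmf_of_set (permutations_of_set {1..K})"

text \<open>Only the ordering is sent, coded as a number; the position \<open>w\<close> stays
  secret. For admissible \<open>(W, S)\<close> the conditioning event has positive
  probability.\<close>

definition pc_query :: "nat \<Rightarrow> nat \<Rightarrow> nat \<Rightarrow> nat set \<Rightarrow> nat list \<Rightarrow> nat pmf" where
  "pc_query K M W S C = do {
     w \<leftarrow> pmf_of_set {..<K};
     xs \<leftarrow> cond_pmf (orderings K) {xs. split_block K M w xs = (W, S)};
     return_pmf (to_nat xs)
   }"

text \<open>The coefficient vectors are the indicators of the blocks, listed explicitly to match the
  shape required by \<open>scalar_linear\<close>.\<close>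

definition pc_answer :: "nat \<Rightarrow> nat \<Rightarrow> (nat, nat, nat list) answer_map" where
  "pc_answer K M Q b X = map (\<lambda>a. \<Oplus>\<^bsub>gf2\<^esub>i\<in>{1..K}. a i \<otimes>\<^bsub>gf2\<^esub> X i)
     (map (\<lambda>j i. if i \<in> (!) (from_nat Q) ` block K M j then 1 else 0) [0..<num_blocks K M])"

definition demand_supp_pairs :: "nat \<Rightarrow> nat \<Rightarrow> (nat \<times> nat set) set" where
  "demand_supp_pairs K M = {(W, S). S \<in> support_sets K M \<and> W \<in> {1..K} - S}"

section \<open>Positions, blocks and orderings\<close>

lemma block_subset: "M < K \<Longrightarrow> block K M j \<subseteq> {..<K}"
  by (auto simp: block_def Let_def)

lemma card_block: "card (block K M j) = M + 1"
  by (simp add: block_def Let_def)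

text \<open>If the block is not shifted, this is division with remainder. If it is, it starts at
  \<open>K - (M + 1)\<close>, which is at most \<open>w\<close>, and ends at
  \<open>K\<close>.\<close>

lemma mem_block_of: "w < K \<Longrightarrow> M < K \<Longrightarrow> w \<in> block_of K M w"
  using div_mult_mod_eq[of w "M + 1"] mod_less_divisor[of "M + 1" w]
  by (auto simp: block_of_def block_def Let_def min_def simp del: mod_less_divisor)

lemma div_less_num_blocks: "w < K \<Longrightarrow> w div (M + 1) < num_blocks K M"
  unfolding num_blocks_def using div_le_mono[of "w + (M + 1)" "K + M" "M + 1"] div_add_self2[of "M + 1" w] by simp

lemma ordering_nth:
  assumes "xs \<in> permutations_of_set {1..K}"
  shows "length xs = K" "bij_betw ((!) xs) {..<K} {1..K}"
proof -
  have xs: "distinct xs" "set xs = {1..K}" using assms by (auto simp: permutations_of_set_def)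
  then show "length xs = K" using distinct_card[of xs] by simp
  then show "bij_betw ((!) xs) {..<K} {1..K}" using bij_betw_nth[of xs "{..<K}" "{1..K}"] xs by simp
qed

section \<open>Symmetry under relabelling and the law of demand and support\<close>

lemma set_pmf_orderings: "set_pmf (orderings K) = permutations_of_set {1..K}"
  by (simp add: orderings_def)

lemma map_orderings:
  assumes "bij_betw \<tau> {1..K} {1..K}"
  shows "map_pmf (map \<tau>) (orderings K) = orderings K"
  unfolding orderings_def
proof (rule map_pmf_of_set_bij_betw)
  have "inj_on (map \<tau>) (permutations_of_set {1..K})"
    using bij_betw_imp_inj_on[OF assms]
    by (intro inj_onI) (auto simp: permutations_of_set_def dest: map_inj_on)
  moreover have "map \<tau> ` permutations_of_set {1..K} = permutations_of_set {1..K}"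
    using permutations_of_set_image_inj[OF bij_betw_imp_inj_on[OF assms]] bij_betw_imp_surj_on[OF assms]
    by simp
  ultimately show "bij_betw (map \<tau>) (permutations_of_set {1..K}) (permutations_of_set {1..K})"
    by (simp add: bij_betw_def)
qed auto

lemma split_block_mem:
  assumes "M < K" "w < K" "xs \<in> permutations_of_set {1..K}"
  shows "split_block K M w xs \<in> demand_supp_pairs K M"
proof -
  note xs = ordering_nth[OF assms(3)]
  have B: "block_of K M w \<subseteq> {..<K}" using block_subset[OF assms(1)] by (simp add: block_of_def)
  have inj: "inj_on ((!) xs) {..<K}" using xs(2) by (rule bij_betw_imp_inj_on)
  have img: "(!) xs ` {..<K} = {1..K}" using xs(2) by (rule bij_betw_imp_surj_on)
  have "(!) xs ` (block_of K M w - {w}) \<subseteq> {1..K}" using B img by blast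
  moreover have "card ((!) xs ` (block_of K M w - {w})) = M"
    using mem_block_of[OF assms(2,1)] B
    by (subst card_image[OF inj_on_subset[OF inj]])
       (auto simp: block_of_def card_block card_Diff_singleton)
  moreover have "xs ! w \<in> {1..K}" using img assms(2) by blast
  moreover have "xs ! w \<notin> (!) xs ` (block_of K M w - {w})"
    using B assms(2) inj by (auto dest!: inj_onD[OF inj])
  ultimately show ?thesis
    by (simp add: split_block_def demand_supp_pairs_def support_sets_def)
qed

lemma split_block_map:
  assumes "M < K" "w < K" "xs \<in> permutations_of_set {1..K}"
  shows "split_block K M w (map \<tau> xs) = map_prod \<tau> (image \<tau>) (split_block K M w xs)"
proof -
  have "block_of K M w \<subseteq> {..<length xs}"
    using block_subset[OF assms(1)] ordering_nth(1)[OF assms(3)] by (simp add: block_of_def)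
  then show ?thesis
    using assms(2) ordering_nth(1)[OF assms(3)]
    by (auto simp: split_block_def image_image intro!: image_cong)
qed

lemma finite_demand_supp_pairs: "finite (demand_supp_pairs K M)"
  by (rule finite_subset[of _ "{1..K} \<times> support_sets K M"])
     (auto simp: demand_supp_pairs_def finite_support_sets)

text \<open>By symmetry: relabelling by a bijection of \<open>{1..K}\<close> preserves \<^const>\<open>orderings\<close>, and these
  bijections act transitively on \<^const>\<open>demand_supp_pairs\<close>.\<close>

lemma map_split_block_orderings:
  assumes MK: "M < K" "w < K"
  shows "map_pmf (split_block K M w) (orderings K) = pmf_of_set (demand_supp_pairs K M)"
proof (rule pmf_of_setI)
  let ?p = "map_pmf (split_block K M w) (orderings K)"
  show "set_pmf ?p \<subseteq> demand_supp_pairs K M"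
    using split_block_mem[OF MK] by (auto simp: set_pmf_orderings)
  fix x y assume x: "x \<in> demand_supp_pairs K M" and y: "y \<in> demand_supp_pairs K M"
  obtain W S W' S' where [simp]: "x = (W, S)" "y = (W', S')" by (cases x, cases y)
  obtain \<tau> where \<tau>: "bij_betw \<tau> {1..K} {1..K}" "\<tau> W = W'" "\<tau> ` S = S'"
    by (rule ex_bij_betw_extending[of "{1..K}" S S' W W'])
       (use x y in \<open>auto simp: demand_supp_pairs_def support_sets_def\<close>)
  have "?p = map_pmf (split_block K M w) (map_pmf (map \<tau>) (orderings K))"
    by (simp only: map_orderings[OF \<tau>(1)])
  also have "\<dots> = map_pmf (map_prod \<tau> (image \<tau>)) ?p"
    unfolding map_pmf_comp using split_block_map[OF MK] by (intro map_pmf_cong) (auto simp: set_pmf_orderings)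
  finally have inv: "?p = map_pmf (map_prod \<tau> (image \<tau>)) ?p" .
  \<comment> \<open>The preimage of the relabelled point contains \<open>x\<close>; by the
    invariance \<open>inv\<close> the right-hand side is \<open>pmf ?p y\<close>.\<close>
  have "pmf ?p x \<le> pmf (map_pmf (map_prod \<tau> (image \<tau>)) ?p) (map_prod \<tau> (image \<tau>) x)"
    by (subst (2) pmf_map) (auto simp flip: measure_pmf_single intro!: measure_pmf.finite_measure_mono)
  then show "pmf ?p x \<le> pmf ?p y" using inv \<tau> by simp
qed (rule finite_demand_supp_pairs)

text \<open>All complements \<open>{1..K} - S\<close> have the same size \<open>K - M\<close>, so
  the two-stage draw gives every admissible pair the same mass.\<close>

lemma demand_supp_uniform:
  assumes MK: "M < K"
  shows "do {S \<leftarrow> pmf_of_set (support_sets K M); W \<leftarrow> pmf_of_set ({1..K} - S); return_pmf (W, S)}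
    = pmf_of_set (demand_supp_pairs K M)" (is "?p = _")
proof (rule pmf_of_setI)
  show "set_pmf ?p \<subseteq> demand_supp_pairs K M"
    by (auto simp: set_pmf_Supp[OF MK] set_pmf_Demand[OF MK, simplified] demand_supp_pairs_def)
  have ne: "support_sets K M \<noteq> {}" using support_sets_nonempty[OF MK, of 1] MK by auto
  have p: "pmf ?p (W, S) = 1 / real (K - M) / real (card (support_sets K M))"
    if "(W, S) \<in> demand_supp_pairs K M" for W S
  proof -
    have S: "S \<in> support_sets K M" and W: "W \<in> {1..K} - S" using that by (auto simp: demand_supp_pairs_def)
    have "pmf (map_pmf (\<lambda>W. (W, S')) (pmf_of_set ({1..K} - S'))) (W, S)
        = (if S = S' then 1 / real (K - M) else 0)" if "S' \<in> support_sets K M" for S'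
    proof (cases "S = S'")
      case True
      have "pmf (map_pmf (\<lambda>W. (W, S)) (pmf_of_set ({1..K} - S))) (W, S) = pmf (pmf_of_set ({1..K} - S)) W"
        by (rule pmf_map_inj') (auto simp: inj_def)
      then show ?thesis
        using True W card_diff_support_set[OF S] by (subst (asm) pmf_of_set) auto
    next
      case False
      then have "(W, S) \<notin> set_pmf (map_pmf (\<lambda>W. (W, S')) (pmf_of_set ({1..K} - S')))" by auto
      then show ?thesis using False by (simp only: set_pmf_iff not_not if_False)
    qed
    then show ?thesis
      using S ne finite_support_sets[of K M]
      by (simp add: pmf_bind integral_pmf_of_set sum.delta map_pmf_def[symmetric])
  qed
  show "pmf ?p x \<le> pmf ?p y" if "x \<in> demand_supp_pairs K M" "y \<in> demand_supp_pairs K M" for x y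
    using p[of "fst x" "snd x"] p[of "fst y" "snd y"] that by simp
qed (rule finite_demand_supp_pairs)

section \<open>Privacy of the protocol\<close>

text \<open>Drawing a function value from its own law and then the argument conditionally on that
  value restores the joint law of value and argument. By \<open>map_split_block_orderings\<close>
  the law of the value is the uniform one.\<close>

lemma resample_ordering:
  assumes "M < K" "w < K"
  shows "do {z \<leftarrow> pmf_of_set (demand_supp_pairs K M);
             xs \<leftarrow> cond_pmf (orderings K) {xs. split_block K M w xs = z};
             return_pmf (z, xs)}
    = map_pmf (\<lambda>xs. (split_block K M w xs, xs)) (orderings K)"
proof -
  let ?D = "pmf_of_set (demand_supp_pairs K M)"
  note D = map_split_block_orderings[OF assms]
  have setD: "set_pmf ?D = split_block K M w ` set_pmf (orderings K)"
    by (simp flip: D)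
  have ne: "set_pmf (orderings K) \<inter> {xs. split_block K M w xs = z} \<noteq> {}" if "z \<in> set_pmf ?D" for z
    using that unfolding setD by blast
  have *: "bind_pmf ?D (\<lambda>z. cond_pmf (orderings K) {xs. split_block K M w xs = z}) = orderings K"
  proof (rule bind_cond_pmf_cancel)
    show "set_pmf ?D \<inter> {z. split_block K M w xs = z} \<noteq> {}" if "xs \<in> set_pmf (orderings K)" for xs
      using that unfolding setD by blast
    show "measure_pmf.prob (orderings K) {xs. split_block K M w xs = z} = measure_pmf.prob ?D {z. split_block K M w xs = z}"
      if "split_block K M w xs = z" for z xs
      using that by (simp flip: D add: vimage_def)
  qed (fact ne)
  have "do {z \<leftarrow> ?D; xs \<leftarrow> cond_pmf (orderings K) {xs. split_block K M w xs = z}; return_pmf (z, xs)}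
    = do {z \<leftarrow> ?D; xs \<leftarrow> cond_pmf (orderings K) {xs. split_block K M w xs = z}; return_pmf (split_block K M w xs, xs)}"
    using set_cond_pmf[OF ne] by (intro bind_pmf_cong refl) auto
  also have "\<dots> = map_pmf (\<lambda>xs. (split_block K M w xs, xs)) (orderings K)"
    by (subst (2) *[symmetric]) (simp only: map_pmf_def bind_assoc_pmf)
  finally show ?thesis .
qed

lemma W_private_pc:
  assumes MK: "M < K"
  shows "W_private (model_I K M gf2 (carrier gf2) (pc_query K M))"
proof -
  define p where "p = model_I K M gf2 (carrier gf2) (pc_query K M)"
  let ?J = "map_pmf (\<lambda>\<omega>. (Demand \<omega>, Query \<omega>)) p"
  have "?J = do {S \<leftarrow> pmf_of_set (support_sets K M); W \<leftarrow> pmf_of_set ({1..K} - S);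
      w \<leftarrow> pmf_of_set {..<K};
      xs \<leftarrow> cond_pmf (orderings K) {xs. split_block K M w xs = (W, S)};
      return_pmf (W, to_nat xs)}"
    by (simp add: p_def model_I_def map_bind_pmf map_return_pmf pc_query_def bind_assoc_pmf bind_return_pmf)
  also have "\<dots> = do {z \<leftarrow> do {S \<leftarrow> pmf_of_set (support_sets K M); W \<leftarrow> pmf_of_set ({1..K} - S); return_pmf (W, S)};
      w \<leftarrow> pmf_of_set {..<K};
      xs \<leftarrow> cond_pmf (orderings K) {xs. split_block K M w xs = z};
      return_pmf (fst z, to_nat xs)}"
    by (simp add: bind_assoc_pmf bind_return_pmf)
  \<comment> \<open>The position is drawn independently of demand and support, so it can be drawn
    first; for fixed \<open>w\<close>, \<open>resample_ordering\<close> then applies.\<close>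
  also have "\<dots> = do {w \<leftarrow> pmf_of_set {..<K}; z \<leftarrow> pmf_of_set (demand_supp_pairs K M);
      xs \<leftarrow> cond_pmf (orderings K) {xs. split_block K M w xs = z};
      return_pmf (fst z, to_nat xs)}"
    unfolding demand_supp_uniform[OF MK] by (rule bind_commute_pmf)
  also have "\<dots> = do {w \<leftarrow> pmf_of_set {..<K};
      map_pmf (map_prod fst to_nat) (do {z \<leftarrow> pmf_of_set (demand_supp_pairs K M);
      xs \<leftarrow> cond_pmf (orderings K) {xs. split_block K M w xs = z};
      return_pmf (z, xs)})}"
    by (simp add: map_bind_pmf map_return_pmf)
  also have "\<dots> = do {w \<leftarrow> pmf_of_set {..<K}; xs \<leftarrow> orderings K; return_pmf (xs ! w, to_nat xs)}"
  proof (intro bind_pmf_cong refl)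
    fix w assume "w \<in> set_pmf (pmf_of_set {..<K})"
    then have w: "w < K" using MK by (subst (asm) set_pmf_of_set) auto
    show "map_pmf (map_prod fst to_nat) (do {z \<leftarrow> pmf_of_set (demand_supp_pairs K M);
      xs \<leftarrow> cond_pmf (orderings K) {xs. split_block K M w xs = z};
      return_pmf (z, xs)}) = do {xs \<leftarrow> orderings K; return_pmf (xs ! w, to_nat xs)}"
      unfolding resample_ordering[OF MK w]
      by (simp add: map_pmf_comp split_block_def) (simp add: map_pmf_def)
  qed
  \<comment> \<open>Position and ordering are now independent. Given the ordering, the demand is the
    entry at a uniform position, hence uniform because an ordering is a bijection.\<close>
  also have "\<dots> = do {xs \<leftarrow> orderings K; W \<leftarrow> map_pmf ((!) xs) (pmf_of_set {..<K}); return_pmf (W, to_nat xs)}"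
    by (subst bind_commute_pmf) (simp add: bind_map_pmf)
  also have "\<dots> = do {xs \<leftarrow> orderings K; W \<leftarrow> pmf_of_set {1..K}; return_pmf (W, to_nat xs)}"
  proof (intro bind_pmf_cong refl)
    fix xs assume "xs \<in> set_pmf (orderings K)"
    then have "bij_betw ((!) xs) {..<K} {1..K}" by (intro ordering_nth) (simp add: set_pmf_orderings)
    then show "map_pmf ((!) xs) (pmf_of_set {..<K}) = pmf_of_set {1..K}"
      using MK by (intro map_pmf_of_set_bij_betw) auto
  qed
  also have "\<dots> = pair_pmf (pmf_of_set {1..K}) (map_pmf to_nat (orderings K))"
    unfolding pair_pmf_def by (subst bind_commute_pmf) (simp add: bind_map_pmf)
  finally have J: "?J = pair_pmf (pmf_of_set {1..K}) (map_pmf to_nat (orderings K))" .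
  have "map_pmf Demand p = map_pmf fst ?J" "map_pmf Query p = map_pmf snd ?J"
    by (simp_all add: map_pmf_comp)
  then have "?J = pair_pmf (map_pmf Demand p) (map_pmf Query p)"
    unfolding J by (simp add: map_fst_pair_pmf map_snd_pair_pmf)
  then show ?thesis
    unfolding p_def W_private_model_I_iff[OF finite_field_ext_gf2 MK] .
qed

section \<open>Recoverability of the protocol\<close>

lemma message_tuples_gf2:
  assumes "X \<in> message_tuples K gf2" "i \<in> {1..K}"
  shows "X i \<in> {0, 1}"
  using assms PiE_mem[of X "{1..K}" "\<lambda>_. carrier gf2" i] by (simp add: message_tuples_def carrier_gf2)

text \<open>The only nonzero coefficient in the two-element field is 1, so the side information is
  the parity of the messages in the support.\<close>

lemma side_info_gf2:
  assumes C: "C \<in> coeff_seqs M gf2 (carrier gf2)" and S: "S \<in> support_sets K M" and X: "X \<in> message_tuples K gf2"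
  shows "side_info gf2 S C X = (\<Sum>i\<in>S. X i) mod 2"
proof -
  have finS: "finite S" using S by (rule finite_support_set)
  have S': "S \<subseteq> {1..K}" "card S = length C" using S C by (auto simp: support_sets_def coeff_seqs_def)
  have bij: "bij_betw ((!) (sorted_list_of_set S)) {..<card S} S"
    using finS by (intro bij_betw_nth) auto
  have C1: "C ! j = 1" if "j < card S" for j
  proof -
    have "C ! j \<in> set C" using that S' by (intro nth_mem) simp
    then show ?thesis using C by (auto simp: coeff_seqs_def carrier_gf2)
  qed
  have X01: "X (sorted_list_of_set S ! j) \<in> {0, 1}" if "j < card S" for j
    using message_tuples_gf2[OF X] bij_betwE[OF bij] that S' by blast
  have "side_info gf2 S C X = (\<Sum>j<card S. C ! j * X (sorted_list_of_set S ! j)) mod 2"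
    unfolding side_info_def using X01 C1 by (subst finsum_gf2) auto
  also have "(\<Sum>j<card S. C ! j * X (sorted_list_of_set S ! j)) = (\<Sum>j<card S. X (sorted_list_of_set S ! j))"
    by (intro sum.cong) (auto simp: C1)
  also have "\<dots> = (\<Sum>i\<in>S. X i)"
    by (rule sum.reindex_bij_betw[OF bij])
  finally show ?thesis .
qed

lemma pc_answer_nth:
  assumes X: "X \<in> message_tuples K gf2" and j: "j < num_blocks K M"
    and sub: "(!) (from_nat Q) ` block K M j \<subseteq> {1..K}"
  shows "pc_answer K M Q b X ! j = (\<Sum>i\<in>(!) (from_nat Q) ` block K M j. X i) mod 2"
proof -
  let ?B = "(!) (from_nat Q) ` block K M j"
  have "pc_answer K M Q b X ! j = (\<Oplus>\<^bsub>gf2\<^esub>i\<in>{1..K}. (if i \<in> ?B then 1 else 0) * X i)"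
    using j by (simp add: pc_answer_def)
  also have "\<dots> = (\<Sum>i\<in>{1..K}. (if i \<in> ?B then 1 else 0) * X i) mod 2"
    using message_tuples_gf2[OF X] by (intro finsum_gf2) auto
  also have "(\<Sum>i\<in>{1..K}. (if i \<in> ?B then 1 else 0) * X i) = (\<Sum>i\<in>{1..K} \<inter> ?B. X i)"
    by (subst sum.inter_restrict) (auto intro!: sum.cong)
  also have "{1..K} \<inter> ?B = ?B" using sub by blast
  finally show ?thesis .
qed

text \<open>The messages at the positions in the block of \<open>w\<close> are the demand and the
  support, so that entry of the answer is the demanded message plus the side information, modulo
  2.\<close>

lemma recoverable_pc:
  assumes MK: "M < K"
  shows "recoverable gf2 (model_I K M gf2 (carrier gf2) (pc_query K M)) (pc_answer K M)"
  unfolding recoverable_model_I_iff[OF finite_field_ext_gf2 MK]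
proof (intro ballI impI)
  fix \<omega> X
  assume \<omega>: "\<omega> \<in> set_pmf (model_I K M gf2 (carrier gf2) (pc_query K M))" and X: "X \<in> message_tuples K gf2"
    and eq: "pc_answer K M (Query \<omega>) False X = pc_answer K M (Query \<omega>) False (Msgs \<omega>) \<and>
      side_info gf2 (Supp \<omega>) (Coeffs \<omega>) X = side_info gf2 (Supp \<omega>) (Coeffs \<omega>) (Msgs \<omega>)"
  define W S where "W = Demand \<omega>" and "S = Supp \<omega>"
  from \<omega> have S: "S \<in> support_sets K M" and W: "W \<in> {1..K} - S" and C: "Coeffs \<omega> \<in> coeff_seqs M gf2 (carrier gf2)"
    and Y: "Msgs \<omega> \<in> message_tuples K gf2" and Q: "Query \<omega> \<in> set_pmf (pc_query K M W S (Coeffs \<omega>))"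
    by (simp_all add: set_pmf_model_I[OF finite_field_ext_gf2 MK] S_def W_def)
  have WS: "(W, S) \<in> set_pmf (pmf_of_set (demand_supp_pairs K M))"
    using S W finite_demand_supp_pairs[of K M]
    by (subst set_pmf_of_set) (auto simp: demand_supp_pairs_def)
  have "set_pmf (pmf_of_set {..<K}) = {..<K}" using MK by (intro set_pmf_of_set) auto
  with Q obtain w xs where w: "w < K" and Qx: "Query \<omega> = to_nat xs"
    and xs: "xs \<in> set_pmf (cond_pmf (orderings K) {xs. split_block K M w xs = (W, S)})"
    by (auto simp: pc_query_def)
  have "set_pmf (orderings K) \<inter> {xs. split_block K M w xs = (W, S)} \<noteq> {}"
    using WS by (auto simp flip: map_split_block_orderings[OF MK w])
  from xs[unfolded set_cond_pmf[OF this]]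
  have "xs \<in> permutations_of_set {1..K}" and sb: "xs ! w = W" "(!) xs ` (block_of K M w - {w}) = S"
    by (auto simp: set_pmf_orderings split_block_def)
  define j where "j = w div (M + 1)"
  have j: "j < num_blocks K M" using div_less_num_blocks[OF w] by (simp add: j_def)
  have "block K M j = insert w (block_of K M w - {w})"
    using mem_block_of[OF w MK] by (auto simp: block_of_def j_def)
  then have B: "(!) (from_nat (Query \<omega>)) ` block K M j = insert W S"
    by (simp only: Qx from_nat_to_nat image_insert sb)
  have sub: "insert W S \<subseteq> {1..K}" using W S by (auto simp: support_sets_def)
  have finS: "finite S" using S by (rule finite_support_set)
  have ans: "pc_answer K M (Query \<omega>) False Z ! j = (Z W + (\<Sum>i\<in>S. Z i)) mod 2"
    if "Z \<in> message_tuples K gf2" for Z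
    using pc_answer_nth[OF that j, of "Query \<omega>"] sub W finS unfolding B by simp
  have 1: "(X W + (\<Sum>i\<in>S. X i)) mod 2 = (Msgs \<omega> W + (\<Sum>i\<in>S. Msgs \<omega> i)) mod 2"
    using eq ans[OF X] ans[OF Y] by simp
  have 2: "(\<Sum>i\<in>S. X i) mod 2 = (\<Sum>i\<in>S. Msgs \<omega> i) mod 2"
    using eq side_info_gf2[OF C S X] side_info_gf2[OF C S Y] by (simp add: S_def)
  have "X W \<in> {0, 1}" "Msgs \<omega> W \<in> {0, 1}"
    using message_tuples_gf2[OF X, of W] message_tuples_gf2[OF Y, of W] W by auto
  \<comment> \<open>Equal parities of the block sums and of the support sums leave equal parities of
    the demanded bits, and a bit is determined by its parity.\<close>
  with 1 2 have "X W = Msgs \<omega> W" by auto presburger+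
  then show "X (Demand \<omega>) = Msgs \<omega> (Demand \<omega>)" by (simp add: W_def)
qed

lemma pir_csi_I_pc:
  assumes "M < K"
  shows "pir_csi_I K M gf2 (carrier gf2) (pc_query K M) (pc_answer K M)"
  using recoverable_pc[OF assms] W_private_pc[OF assms] by (simp add: pir_csi_I_def)

section \<open>Linearity and exact rate of the protocol\<close>

lemma scalar_linear_pc: "scalar_linear K gf2 (carrier gf2) (pc_answer K M)"
  unfolding scalar_linear_def
  by (intro exI[of _ "\<lambda>Q. map (\<lambda>j i. if i \<in> (!) (from_nat Q) ` block K M j then 1 else 0) [0..<num_blocks K M]"])
     (auto simp: pc_answer_def carrier_gf2)

text \<open>An answer is a binary word with one letter per block, so at most
  \<open>2 ^ num_blocks K M\<close> values occur.\<close>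

lemma entropy_pc_le:
  assumes "M < K"
  shows "entropy_bits (model_I K M gf2 (carrier gf2) (pc_query K M)) (Answer (pc_answer K M)) \<le> ereal (real (num_blocks K M))"
proof -
  let ?A = "{xs. set xs \<subseteq> {0, 1 :: nat} \<and> length xs = num_blocks K M}"
  have "Answer (pc_answer K M) ` set_pmf (model_I K M gf2 (carrier gf2) (pc_query K M)) \<subseteq> ?A"
  proof (rule image_subsetI)
    fix \<omega> assume "\<omega> \<in> set_pmf (model_I K M gf2 (carrier gf2) (pc_query K M))"
    then have "Msgs \<omega> \<in> message_tuples K gf2"
      by (simp add: set_pmf_model_I[OF finite_field_ext_gf2 assms])
    then have "Msgs \<omega> i \<in> carrier gf2" if "i \<in> {1..K}" for i
      using message_tuples_gf2[OF _ that] by (simp add: carrier_gf2)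
    moreover have "abelian_monoid gf2"
      using field_gf2 by (intro abelian_group.axioms ring.is_abelian_group field.is_ring)
    ultimately have "(\<Oplus>\<^bsub>gf2\<^esub>i\<in>{1..K}. (if i \<in> B then 1 else 0) \<otimes>\<^bsub>gf2\<^esub> Msgs \<omega> i) \<in> carrier gf2" for B
      by (intro abelian_monoid.finsum_closed Pi_I) (auto simp: carrier_gf2)
    then have "set (Answer (pc_answer K M) \<omega>) \<subseteq> carrier gf2"
      unfolding Answer_def pc_answer_def set_map image_image by (intro image_subsetI)
    then show "Answer (pc_answer K M) \<omega> \<in> ?A"
      by (simp add: carrier_gf2 Answer_def pc_answer_def)
  qed
  then have "entropy_bits (model_I K M gf2 (carrier gf2) (pc_query K M)) (Answer (pc_answer K M)) \<le> ereal (log 2 (real (card ?A)))"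
    by (intro entropy_bits_le_log_card finite_lists_length_eq) auto
  also have "card ?A = 2 ^ num_blocks K M"
    by (subst card_lists_length_eq) (auto simp: numeral_2_eq_2)
  finally show ?thesis by simp
qed

lemma num_blocks_bounds:
  "num_blocks K M * (M + 1) < K + (M + 1)" "K \<le> num_blocks K M * (M + 1)"
proof -
  have "num_blocks K M * (M + 1) + (K + M) mod (M + 1) = K + M"
    unfolding num_blocks_def by (rule div_mult_mod_eq)
  moreover have "(K + M) mod (M + 1) < M + 1" by simp
  ultimately show "num_blocks K M * (M + 1) < K + (M + 1)" "K \<le> num_blocks K M * (M + 1)"
    by linarith+
qed

lemma num_blocks_ceiling: "real_of_int \<lceil>real K / real (M + 1)\<rceil> = real (num_blocks K M)"
proof -
  have "real (num_blocks K M * (M + 1)) < real (K + (M + 1))" "real K \<le> real (num_blocks K M * (M + 1))"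
    using num_blocks_bounds[of K M] by (simp_all only: of_nat_less_iff of_nat_le_iff)
  then have "\<lceil>real K / real (M + 1)\<rceil> = int (num_blocks K M)"
    by (intro ceiling_unique) (simp_all add: field_simps)
  then show ?thesis by simp
qed

lemma num_blocks_pos: "0 < K \<Longrightarrow> 0 < num_blocks K M"
  using num_blocks_bounds(2)[of K M] by (cases "num_blocks K M") auto

text \<open>The counting bound and the converse, applied to the protocol itself, pin the answer
  entropy to \<open>num_blocks K M\<close> bits, and a message carries one bit.\<close>

lemma rate_pc:
  assumes MK: "M < K"
  shows "rate K M 2 1 gf2 (carrier gf2) (pc_query K M) (pc_answer K M) = ereal (1 / real (num_blocks K M))"
proof -
  have "entropy_bits (model_I K M gf2 (carrier gf2) (pc_query K M)) (Answer (pc_answer K M)) = ereal (real (num_blocks K M))"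
    using entropy_pc_le[OF MK]
      entropy_Answer_ge[OF finite_field_ext_gf2 MK pir_csi_I_pc[OF MK] num_blocks_bounds(1)]
    by (intro antisym) simp_all
  then show ?thesis
    using num_blocks_pos[of K M] MK unfolding rate_eq[OF finite_field_ext_gf2 MK] by simp
qed

theorem theorem3:
  fixes K M :: nat
  assumes "1 \<le> M" and "M \<le> K - 1"
  shows "capacity K M = ereal (inverse (real_of_int \<lceil>real K / real (M + 1)\<rceil>)) \<and>
         scalar_linear_capacity K M = ereal (inverse (real_of_int \<lceil>real K / real (M + 1)\<rceil>))"
proof -
  have MK: "M < K" using assms by linarith
  have n: "num_blocks K M > 0" using MK by (intro num_blocks_pos) simp
  \<comment> \<open>One bound serves both suprema, since scalar-linear protocols are among all
    protocols; the binary protocol attains it in both.\<close>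
  note upper = rate_le[OF _ MK _ num_blocks_bounds(1) n]
  show ?thesis
    unfolding num_blocks_ceiling inverse_eq_divide capacity_def scalar_linear_capacity_def
  proof (intro conjI antisym Sup_least Sup_upper)
    show "ereal (1 / real (num_blocks K M)) \<in> {rate K M q l F k query answer | q l (F :: nat ring) k
            (query :: (nat, nat) query_kernel) (answer :: (nat, nat, nat list) answer_map).
          finite_field_ext q l F k \<and> pir_csi_I K M F k query answer \<and> scalar_linear K F k answer}"
      using rate_pc[OF MK] finite_field_ext_gf2 pir_csi_I_pc[OF MK] scalar_linear_pc by (smt (verit) mem_Collect_eq)
    show "ereal (1 / real (num_blocks K M)) \<in> {rate K M q l F k query answer | q l (F :: nat ring) k
            (query :: (nat, nat) query_kernel) (answer :: (nat, nat, nat list) answer_map).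
          finite_field_ext q l F k \<and> pir_csi_I K M F k query answer}"
      using rate_pc[OF MK] finite_field_ext_gf2 pir_csi_I_pc[OF MK] by (smt (verit) mem_Collect_eq)
  qed (auto intro: upper)
qed

end
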